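(* Let $k\in\mathbb{N}$ and let $A\subseteq Ct_{\mathbb{N}}(k)$ be a $\tilde\Pi^0_1$-set. (a) If $f: A\to\mathbb{R}$ is continuous, then $f$ can be extended to a continuous $g: Ct_{\mathbb{N}}(k)\to\mathbb{R}$ in such a way that the map $f\mapsto g$ is continuous. (b) If $f: A\to\mathbb{N}$ is continuous, then $f$ can be extended to a continuous $g: Ct_{\mathbb{N}}(k)\to\mathbb{N}$ in such a way that the map $f\mapsto g$ is continuous.
   Context: $Ct_{\mathbb{N}}(k)$ denotes the Kleene–Kreisel continuous functionals of pure type $k$: $Ct_{\mathbb{N}}(0)=\mathbb{N}$ and $Ct_{\mathbb{N}}(k+1)$ is the set of continuous maps $Ct_{\mathbb{N}}(k)\to\mathbb{N}$; concretely, with $N(0)=\mathbb{N}_\bot$, $N(k+1)=N(k)\to N(0)$ (Scott-continuous maps), $\bar N(k)$ the hereditarily total elements ($n\approx^N_0 m$ iff $n=m\in\mathbb{N}$; $f\approx^N_{k+1}g$ iff $f(a)\approx^N_0 g(b)$ whenever $a\approx^N_k b$; $\bar N(k)=\{x: x\approx^N_k x\}$), $Ct_{\mathbb{N}}(k)$ is $\bar N(k)/\approx^N_k$ with the quotient topology. A set $A\subseteq Ct_{\mathbb{N}}(k)$ is $\tilde\Pi^0_1$ if it is the intersection of countably many clopen subsets of $Ct_{\mathbb{N}}(k)$; $A$ carries the subspace topology. For $B\subseteq Ct_{\mathbb{N}}(k)$ (including $B=A$ and $B=Ct_{\mathbb{N}}(k)$), the set of continuous functions $B\to\mathbb{R}$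 (resp. $B\to\mathbb{N}$) carries the finest topology in which $f=\lim_n f_n$ holds exactly when for every $a\in B$ and every sequence $(a_n)$ in $B$ converging to $a$ we have $f(a)=\lim_n f_n(a_n)$. *)

theory Defs
  imports "HOL-Analysis.Analysis" "HOL-Library.FSet"
begin

section \<open>Scott topology and quotient topology\<close>

definition directed_set :: "'a::order set \<Rightarrow> bool" where
  "directed_set S \<longleftrightarrow> S \<noteq> {} \<and> (\<forall>x\<in>S. \<forall>y\<in>S. \<exists>z\<in>S. x \<le> z \<and> y \<le> z)"

definition is_lub_in :: "'a::order set \<Rightarrow> 'a set \<Rightarrow> 'a \<Rightarrow> bool" where
  "is_lub_in D S s \<longleftrightarrow> s \<in> D \<and> (\<forall>x\<in>S. x \<le> s) \<and> (\<forall>u\<in>D. (\<forall>x\<in>S. x \<le> u) \<longrightarrow> s \<le> u)"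

definition scott_open :: "'a::order set \<Rightarrow> 'a set \<Rightarrow> bool" where
  "scott_open D U \<longleftrightarrow> U \<subseteq> D \<and> (\<forall>x\<in>U. \<forall>y\<in>D. x \<le> y \<longrightarrow> y \<in> U) \<and>
     (\<forall>S s. S \<subseteq> D \<and> directed_set S \<and> is_lub_in D S s \<and> s \<in> U \<longrightarrow> S \<inter> U \<noteq> {})"

lemma scott_open_up: "scott_open D U \<Longrightarrow> x \<in> U \<Longrightarrow> y \<in> D \<Longrightarrow> x \<le> y \<Longrightarrow> y \<in> U"
  by (auto simp: scott_open_def)

lemma scott_open_sup:
  "scott_open D U \<Longrightarrow> S \<subseteq> D \<Longrightarrow> directed_set S \<Longrightarrow> is_lub_in D S s \<Longrightarrow> s \<in> U \<Longrightarrow> \<exists>x\<in>S. x \<in> U"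
  unfolding scott_open_def by blast

definition scott_topology :: "'a::order set \<Rightarrow> 'a topology" where
  "scott_topology D = topology (scott_open D)"

lemma istopology_scott_open: "istopology (scott_open D)"
  unfolding istopology_def
proof (intro conjI allI impI)
  fix U V assume U: "scott_open D U" and V: "scott_open D V"
  show "scott_open D (U \<inter> V)"
    unfolding scott_open_def
  proof (intro conjI allI impI)
    show "U \<inter> V \<subseteq> D" using U by (auto simp: scott_open_def)
    show "\<forall>x\<in>U \<inter> V. \<forall>y\<in>D. x \<le> y \<longrightarrow> y \<in> U \<inter> V"
      using U V by (auto simp: scott_open_def)
    fix S s assume S: "S \<subseteq> D \<and> directed_set S \<and> is_lub_in D S s \<and> s \<in> U \<inter> V"
    obtain x where x: "x \<in> S" "x \<in> U" using scott_open_sup[OF U] S by blast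
    obtain y where y: "y \<in> S" "y \<in> V" using scott_open_sup[OF V] S by blast
    obtain z where z: "z \<in> S" "x \<le> z" "y \<le> z"
      using S x y unfolding directed_set_def by blast
    then have "z \<in> U" "z \<in> V"
      using scott_open_up[OF U x(2)] scott_open_up[OF V y(2)] S by auto
    then show "S \<inter> (U \<inter> V) \<noteq> {}" using z by blast
  qed
next
  fix \<U> assume "\<forall>U\<in>\<U>. scott_open D U"
  then show "scott_open D (\<Union>\<U>)"
    unfolding scott_open_def by (simp add: Union_least disjoint_iff) (metis)
qed

lemma openin_scott: "openin (scott_topology D) U \<longleftrightarrow> scott_open D U"
  by (simp add: scott_topology_def istopology_scott_open)

lemma topspace_scott [simp]: "topspace (scott_topology D) = D"
proof -
  have "scott_open D D"
    unfolding scott_open_def directed_set_def by blast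
  then show ?thesis
    unfolding topspace_def openin_scott by (auto simp: scott_open_def)
qed

definition quotient_topology :: "'a topology \<Rightarrow> ('a \<Rightarrow> 'b) \<Rightarrow> 'b topology" where
  "quotient_topology X q =
     topology (\<lambda>V. V \<subseteq> q ` topspace X \<and> openin X {x \<in> topspace X. q x \<in> V})"

lemma openin_quotient_topology:
  "openin (quotient_topology X q) V \<longleftrightarrow>
     V \<subseteq> q ` topspace X \<and> openin X {x \<in> topspace X. q x \<in> V}"
proof -
  have "istopology (\<lambda>V. V \<subseteq> q ` topspace X \<and> openin X {x \<in> topspace X. q x \<in> V})"
    unfolding istopology_def
  proof (intro conjI allI impI)
    fix U V
    assume "U \<subseteq> q ` topspace X \<and> openin X {x \<in> topspace X. q x \<in> U}"
      and "V \<subseteq> q ` topspace X \<and> openin X {x \<in> topspace X. q x \<in> V}"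
    moreover have "{x \<in> topspace X. q x \<in> U \<inter> V} =
        {x \<in> topspace X. q x \<in> U} \<inter> {x \<in> topspace X. q x \<in> V}" by auto
    ultimately show "openin X {x \<in> topspace X. q x \<in> U \<inter> V}" "U \<inter> V \<subseteq> q ` topspace X"
      by auto
  next
    fix \<V>
    assume *: "\<forall>V\<in>\<V>. V \<subseteq> q ` topspace X \<and> openin X {x \<in> topspace X. q x \<in> V}"
    have "{x \<in> topspace X. q x \<in> \<Union>\<V>} = (\<Union>V\<in>\<V>. {x \<in> topspace X. q x \<in> V})" by auto
    then show "openin X {x \<in> topspace X. q x \<in> \<Union>\<V>}" using * by auto
    show "\<Union>\<V> \<subseteq> q ` topspace X" using * by auto
  qed
  then show ?thesis by (simp add: quotient_topology_def)
qed

lemma topspace_quotient_topology [simp]: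
  "topspace (quotient_topology X q) = q ` topspace X"
proof -
  have "{x \<in> topspace X. q x \<in> q ` topspace X} = topspace X" by auto
  then have "openin (quotient_topology X q) (q ` topspace X)"
    by (simp add: openin_quotient_topology)
  then show ?thesis
    by (metis (no_types, lifting) openin_quotient_topology openin_subset openin_topspace subset_antisym)
qed

lemma quotient_map_quotient_topology: "quotient_map X (quotient_topology X q) q"
  by (simp add: quotient_map_def openin_quotient_topology)


section \<open>The domains of partial functionals of pure type\<close>

text \<open>
  All the domains \<open>N(k)\<close> have to live in a single HOL type. A Scott-continuous map
  from \<open>N(k)\<close> to \<open>N(0)\<close> is stored as the set of all tokens \<open>Arr X n\<close> such
  that \<open>X\<close> is a finite piece of information, contained in some element of \<open>N(k)\<close>,
  that forces the value \<open>n\<close>. The order on every domain is then inclusion.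
  The lemmas \<open>pdom_Suc_bij\<close> and \<open>pdom_Suc_order\<close> below show that this coding is
  faithful: \<open>pdom (Suc k)\<close>, acting through \<open>app\<close>, is exactly the set of Scott-continuous maps
  from \<open>pdom k\<close> to \<open>pdom 0\<close> with the pointwise order.
\<close>

datatype tok = Num nat | Arr "tok fset" nat

definition enc :: "tok set set \<Rightarrow> (tok set \<Rightarrow> tok set) \<Rightarrow> tok set" where
  "enc D f = {Arr X n | X n. (\<exists>a\<in>D. fset X \<subseteq> a) \<and> (\<forall>a\<in>D. fset X \<subseteq> a \<longrightarrow> f a = {Num n})}"

definition app :: "tok set \<Rightarrow> tok set \<Rightarrow> tok set" where
  "app F a = {Num n | X n. fset X \<subseteq> a \<and> Arr X n \<in> F}"

text \<open>The flat domain of natural numbers, with \<open>{}\<close> as bottom and \<open>{Num n}\<close> as \<open>n\<close>.\<close>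

definition nat_bot :: "tok set set" where
  "nat_bot = insert {} (range (\<lambda>n. {Num n}))"

primrec pdom :: "nat \<Rightarrow> tok set set" where
  "pdom 0 = nat_bot"
| "pdom (Suc k) =
     enc (pdom k) ` {f. continuous_map (scott_topology (pdom k)) (scott_topology nat_bot) f}"


subsection \<open>Correctness of the coding\<close>

definition good_dom :: "tok set set \<Rightarrow> bool" where
  "good_dom D \<longleftrightarrow>
     (\<forall>S. S \<subseteq> D \<and> directed_set S \<longrightarrow> \<Union>S \<in> D) \<and>
     (\<forall>X. finite X \<and> (\<exists>a\<in>D. X \<subseteq> a) \<longrightarrow>
        (\<exists>c\<in>D. X \<subseteq> c \<and> (\<forall>a\<in>D. X \<subseteq> a \<longrightarrow> c \<subseteq> a)))"

abbreviation scott_maps :: "tok set set \<Rightarrow> (tok set \<Rightarrow> tok set) set" where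
  "scott_maps D \<equiv> {f. continuous_map (scott_topology D) (scott_topology nat_bot) f}"

lemma good_dom_Union: "good_dom D \<Longrightarrow> S \<subseteq> D \<Longrightarrow> directed_set S \<Longrightarrow> \<Union>S \<in> D"
  by (simp add: good_dom_def)

lemma good_dom_least:
  assumes "good_dom D" "finite X" "a \<in> D" "X \<subseteq> a"
  obtains c where "c \<in> D" "X \<subseteq> c" "\<And>b. b \<in> D \<Longrightarrow> X \<subseteq> b \<Longrightarrow> c \<subseteq> b"
  using assms unfolding good_dom_def by meson

lemma finite_subset_directed_Union:
  assumes "finite X" "X \<subseteq> \<Union>S" "directed_set S"
  shows "\<exists>s\<in>S. X \<subseteq> (s::'a set)"
  using assms
proof (induction X rule: finite_induct)
  case empty
  then show ?case by (auto simp: directed_set_def)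
next
  case (insert x X)
  then obtain s t where "s \<in> S" "X \<subseteq> s" "t \<in> S" "x \<in> t" by auto
  moreover obtain u where "u \<in> S" "s \<subseteq> u" "t \<subseteq> u"
    using insert.prems(2) calculation unfolding directed_set_def by metis
  ultimately show ?case by blast
qed

lemma scott_open_value:
  assumes f: "f \<in> scott_maps D"
  shows "scott_open D {x \<in> D. f x = {Num n}}"
proof -
  have "scott_open nat_bot {{Num n}}"
    unfolding scott_open_def
  proof (intro conjI allI impI)
    fix S s assume *: "S \<subseteq> nat_bot \<and> directed_set S \<and> is_lub_in nat_bot S s \<and> s \<in> {{Num n}}"
    have "\<exists>x\<in>S. x \<noteq> {}"
    proof (rule ccontr)
      assume "\<not> ?thesis"
      then have "\<forall>x\<in>S. x \<subseteq> {}" by simp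
      moreover have "{} \<in> nat_bot" by (simp add: nat_bot_def)
      ultimately have "s \<subseteq> {}" using * unfolding is_lub_in_def by metis
      then show False using * by auto
    qed
    then obtain x where x: "x \<in> S" "x \<noteq> {}" by metis
    moreover have "x \<subseteq> {Num n}" using * x(1) unfolding is_lub_in_def by auto
    ultimately have "x = {Num n}" by (simp add: subset_singleton_iff)
    then show "S \<inter> {{Num n}} \<noteq> {}" using x(1) by simp
  qed (auto simp: nat_bot_def)
  then have "scott_open D {x \<in> D. f x \<in> {{Num n}}}"
    using f unfolding continuous_map_def openin_scott topspace_scott by blast
  then show ?thesis by simp
qed

lemma enc_D: "Arr X n \<in> enc D f \<Longrightarrow> a \<in> D \<Longrightarrow> fset X \<subseteq> a \<Longrightarrow> f a = {Num n}"
  by (simp add: enc_def)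

lemma enc_I:
  "c \<in> D \<Longrightarrow> fset X \<subseteq> c \<Longrightarrow> (\<And>a. a \<in> D \<Longrightarrow> fset X \<subseteq> a \<Longrightarrow> f a = {Num n}) \<Longrightarrow> Arr X n \<in> enc D f"
  by (auto simp: enc_def)

lemma enc_E:
  assumes "t \<in> enc D f"
  obtains X n c where "t = Arr X n" "c \<in> D" "fset X \<subseteq> c"
    "\<forall>a\<in>D. fset X \<subseteq> a \<longrightarrow> f a = {Num n}"
proof -
  from assms obtain X n where X: "t = Arr X n" "\<exists>c\<in>D. fset X \<subseteq> c"
    "\<forall>a\<in>D. fset X \<subseteq> a \<longrightarrow> f a = {Num n}" by (simp add: enc_def) metis
  then obtain c where "c \<in> D" "fset X \<subseteq> c" by metis
  then show thesis using X by (intro that[of X n c]) simp_all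
qed

lemma app_I: "fset X \<subseteq> a \<Longrightarrow> Arr X n \<in> F \<Longrightarrow> Num n \<in> app F a"
  by (auto simp: app_def)

lemma app_E:
  assumes "t \<in> app F a"
  obtains X n where "t = Num n" "fset X \<subseteq> a" "Arr X n \<in> F"
  using assms unfolding app_def by blast

lemma nat_bot_eqI: "x \<in> nat_bot \<Longrightarrow> Num n \<in> x \<Longrightarrow> x = {Num n}"
  by (auto simp: nat_bot_def)

lemma scott_map_mono:
  assumes f: "f \<in> scott_maps D" and a: "a \<in> D" "b \<in> D" "a \<subseteq> b" and n: "f a = {Num n}"
  shows "f b = {Num n}"
  using scott_open_up[OF scott_open_value[OF f, of n], of a b] a n by simp

lemma scott_map_finite:
  assumes D: "good_dom D" and f: "f \<in> scott_maps D" and a: "a \<in> D" and n: "f a = {Num n}"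
  shows "\<exists>X. finite X \<and> X \<subseteq> a \<and> (\<forall>b\<in>D. X \<subseteq> b \<longrightarrow> f b = {Num n})"
proof -
  note U = scott_open_value[OF f, of n]
  define least where "least = (\<lambda>X c. X \<subseteq> c \<and> (\<forall>b\<in>D. X \<subseteq> b \<longrightarrow> c \<subseteq> b))"
  define S where "S = {c \<in> D. \<exists>X. finite X \<and> X \<subseteq> a \<and> least X c}"
  have ex: "\<exists>c\<in>S. X \<subseteq> c" if "finite X" "X \<subseteq> a" for X
  proof -
    obtain c where c: "c \<in> D" "X \<subseteq> c" "\<And>b. b \<in> D \<Longrightarrow> X \<subseteq> b \<Longrightarrow> c \<subseteq> b"
      using good_dom_least[OF D \<open>finite X\<close> a \<open>X \<subseteq> a\<close>] by blast
    have "least X c" using c(2,3) by (simp add: least_def)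
    then have "c \<in> S" using c(1) that by (auto simp: S_def)
    then show ?thesis using c by blast
  qed
  have below: "c \<subseteq> a" if "c \<in> S" for c
    using that a by (auto simp: S_def least_def)
  have dir: "directed_set S"
    unfolding directed_set_def
  proof (intro conjI ballI)
    show "S \<noteq> {}" using ex[of "{}"] by auto
    fix x y assume "x \<in> S" "y \<in> S"
    then obtain X Y where X: "finite X" "X \<subseteq> a" "least X x" and Y: "finite Y" "Y \<subseteq> a" "least Y y"
      unfolding S_def by blast
    then obtain z where "z \<in> S" "X \<union> Y \<subseteq> z" using ex[of "X \<union> Y"] by auto
    then show "\<exists>z\<in>S. x \<subseteq> z \<and> y \<subseteq> z"
      using X Y by (intro bexI[of _ z]) (auto simp: least_def S_def)
  qed
  have "a \<subseteq> \<Union>S"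
  proof
    fix t assume "t \<in> a" then show "t \<in> \<Union>S" using ex[of "{t}"] by auto
  qed
  then have "is_lub_in D S a"
    unfolding is_lub_in_def using a below by (meson Sup_least order_trans)
  then obtain c where c: "c \<in> S" "f c = {Num n}"
    using scott_open_sup[OF U _ dir, of a] a n by (auto simp: S_def)
  then obtain X where X: "finite X" "X \<subseteq> a" "least X c" "c \<in> D" unfolding S_def by blast
  then have "\<forall>b\<in>D. X \<subseteq> b \<longrightarrow> f b = {Num n}"
    using scott_map_mono[OF f X(4) _ _ c(2)] by (auto simp: least_def)
  then show ?thesis using X by blast
qed

lemma scott_map_nat_bot: "f \<in> scott_maps D \<Longrightarrow> a \<in> D \<Longrightarrow> f a \<in> nat_bot"
  by (auto simp: continuous_map_def)

lemma app_enc: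
  assumes D: "good_dom D" and f: "f \<in> scott_maps D" and a: "a \<in> D"
  shows "app (enc D f) a = f a"
proof
  show "app (enc D f) a \<subseteq> f a" using a by (auto simp: app_def enc_def)
  show "f a \<subseteq> app (enc D f) a"
  proof
    fix t assume t: "t \<in> f a"
    then obtain n where n: "f a = {Num n}" "t = Num n"
      using scott_map_nat_bot[OF f a] by (auto simp: nat_bot_def)
    obtain X where X: "finite X" "X \<subseteq> a" "\<forall>b\<in>D. X \<subseteq> b \<longrightarrow> f b = {Num n}"
      using scott_map_finite[OF D f a n(1)] by blast
    then have "Arr (Abs_fset X) n \<in> enc D f"
      using a by (auto simp: enc_def Abs_fset_inverse)
    then show "t \<in> app (enc D f) a"
      using X n by (auto simp: app_def Abs_fset_inverse intro!: exI[of _ "Abs_fset X"])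
  qed
qed

lemma enc_mono:
  assumes "good_dom D" "f \<in> scott_maps D" "g \<in> scott_maps D"
  shows "enc D f \<subseteq> enc D g \<longleftrightarrow> (\<forall>a\<in>D. f a \<subseteq> g a)"
proof
  assume "enc D f \<subseteq> enc D g"
  then have "app (enc D f) a \<subseteq> app (enc D g) a" for a by (auto simp: app_def)
  then show "\<forall>a\<in>D. f a \<subseteq> g a" using assms by (metis app_enc)
next
  assume *: "\<forall>a\<in>D. f a \<subseteq> g a"
  have g: "g a = {Num n}" if "a \<in> D" "f a = {Num n}" for a n
    using * that scott_map_nat_bot[OF assms(3) that(1)] by (auto simp: nat_bot_def)
  show "enc D f \<subseteq> enc D g"
  proof
    fix t assume "t \<in> enc D f"
    then obtain X n c where X: "t = Arr X n" "c \<in> D" "fset X \<subseteq> c"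
      "\<forall>a\<in>D. fset X \<subseteq> a \<longrightarrow> f a = {Num n}" by (rule enc_E)
    show "t \<in> enc D g" unfolding X(1) by (rule enc_I[OF X(2,3)]) (use g X(4) in simp)
  qed
qed

lemma app_scott_map:
  assumes D: "good_dom D" and G: "\<And>a. a \<in> D \<Longrightarrow> app G a \<in> nat_bot"
  shows "app G \<in> scott_maps D"
proof -
  have mono: "app G a \<subseteq> app G b" if "a \<subseteq> b" for a b using that by (auto simp: app_def)
  have "scott_open D {x \<in> D. app G x \<in> V}" if V: "scott_open nat_bot V" for V
    unfolding scott_open_def
  proof (intro conjI allI impI)
    show "\<forall>x\<in>{x \<in> D. app G x \<in> V}. \<forall>y\<in>D. x \<subseteq> y \<longrightarrow> y \<in> {x \<in> D. app G x \<in> V}"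
      using scott_open_up[OF V] mono G by auto
    fix S s
    assume *: "S \<subseteq> D \<and> directed_set S \<and> is_lub_in D S s \<and> s \<in> {x \<in> D. app G x \<in> V}"
    have "\<Union>S \<in> D" using good_dom_Union[OF D] * by auto
    then have s: "s = \<Union>S" using * by (intro subset_antisym) (auto simp: is_lub_in_def)
    have "\<exists>x\<in>S. app G s \<subseteq> app G x"
    proof (cases "app G s = {}")
      case True
      then show ?thesis using * by (auto simp: directed_set_def)
    next
      case False
      then obtain n where n: "app G s = {Num n}" using G[of s] * by (auto simp: nat_bot_def)
      then obtain X where X: "fset X \<subseteq> s" "Arr X n \<in> G" unfolding app_def by blast
      then obtain x where "x \<in> S" "fset X \<subseteq> x"
        using finite_subset_directed_Union[of "fset X" S] * s by auto
      then show ?thesis using X n by (auto simp: app_def)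
    qed
    then obtain x where x: "x \<in> S" "app G s \<subseteq> app G x" by blast
    have "x \<subseteq> s" using x s by auto
    then have "app G x = app G s" using mono x by blast
    then show "S \<inter> {x \<in> D. app G x \<in> V} \<noteq> {}" using x * by auto
  qed auto
  then show ?thesis using G by (auto simp: continuous_map_def openin_scott)
qed

lemma good_dom_nat_bot: "good_dom nat_bot"
  unfolding good_dom_def
proof (intro conjI allI impI)
  fix S :: "tok set set" assume S: "S \<subseteq> nat_bot \<and> directed_set S"
  show "\<Union>S \<in> nat_bot"
  proof (cases "S \<subseteq> {{}}")
    case True
    then have "\<Union>S = {}" by auto
    then show ?thesis by (simp add: nat_bot_def)
  next
    case False
    then obtain n where n: "{Num n} \<in> S" using S by (auto simp: nat_bot_def)
    have "x \<subseteq> {Num n}" if x: "x \<in> S" for x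
    proof -
      obtain z where z: "z \<in> S" "x \<subseteq> z" "{Num n} \<subseteq> z"
        using S n x unfolding directed_set_def by blast
      then show ?thesis using S by (auto simp: nat_bot_def)
    qed
    then have "\<Union>S = {Num n}" using n by blast
    then show ?thesis by (simp add: nat_bot_def)
  qed
next
  fix X assume X: "finite X \<and> (\<exists>a\<in>nat_bot. X \<subseteq> a)"
  then have "X \<in> nat_bot" by (auto simp: nat_bot_def)
  then show "\<exists>c\<in>nat_bot. X \<subseteq> c \<and> (\<forall>a\<in>nat_bot. X \<subseteq> a \<longrightarrow> c \<subseteq> a)" by blast
qed

lemma good_dom_enc:
  assumes D: "good_dom D"
  shows "good_dom (enc D ` scott_maps D)"
  unfolding good_dom_def
proof (intro conjI allI impI)
  fix S assume S: "S \<subseteq> enc D ` scott_maps D \<and> directed_set S"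
  define G where "G = \<Union>S"
  have loc: "\<exists>f. f \<in> scott_maps D \<and> enc D f \<in> S \<and> t \<in> enc D f" if "t \<in> G" for t
    using that S unfolding G_def by blast
  have nb: "app G a \<in> nat_bot" if a: "a \<in> D" for a
  proof (cases "app G a = {}")
    case False
    then obtain u where "u \<in> app G a" by blast
    then obtain X n where "u = Num n" and X: "fset X \<subseteq> a" "Arr X n \<in> G" by (rule app_E)
    have sub: "t = Num n" if "t \<in> app G a" for t
    proof -
      from that obtain Y m where Y: "t = Num m" "fset Y \<subseteq> a" "Arr Y m \<in> G" by (rule app_E)
      obtain f where f: "enc D f \<in> S" "Arr X n \<in> enc D f" using loc[OF X(2)] by blast
      obtain g where g: "enc D g \<in> S" "Arr Y m \<in> enc D g" using loc[OF Y(3)] by blast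
      obtain F where F: "F \<in> S" "enc D f \<subseteq> F" "enc D g \<subseteq> F"
        using S f(1) g(1) unfolding directed_set_def by meson
      then obtain h where h: "F = enc D h" using S by blast
      have "Arr X n \<in> enc D h" "Arr Y m \<in> enc D h" using F f(2) g(2) h by auto
      then have "h a = {Num n}" "h a = {Num m}"
        using enc_D a X(1) Y(2) by metis+
      then show ?thesis using Y(1) by simp
    qed
    have "Num n \<in> app G a" using X by (rule app_I)
    then have "app G a = {Num n}" by (intro set_eqI) (metis sub singleton_iff)
    then show ?thesis by (simp add: nat_bot_def)
  qed (simp add: nat_bot_def)
  have sc: "app G \<in> scott_maps D" using app_scott_map[OF D nb] .
  have "G = enc D (app G)"
  proof (intro set_eqI iffI)
    fix t assume t: "t \<in> G"
    then obtain f where "t \<in> enc D f" using loc by blast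
    then obtain X n c where X: "t = Arr X n" "c \<in> D" "fset X \<subseteq> c"
      "\<forall>a\<in>D. fset X \<subseteq> a \<longrightarrow> f a = {Num n}" by (rule enc_E)
    have "app G a = {Num n}" if "a \<in> D" "fset X \<subseteq> a" for a
      using nat_bot_eqI[OF nb app_I] that t X(1) by blast
    then show "t \<in> enc D (app G)" unfolding X(1) by (rule enc_I[OF X(2,3)])
  next
    fix t assume "t \<in> enc D (app G)"
    then obtain X n d where t: "t = Arr X n" "d \<in> D" "fset X \<subseteq> d"
      "\<forall>a\<in>D. fset X \<subseteq> a \<longrightarrow> app G a = {Num n}" by (rule enc_E)
    obtain c where c: "c \<in> D" "fset X \<subseteq> c" "\<And>a. a \<in> D \<Longrightarrow> fset X \<subseteq> a \<Longrightarrow> c \<subseteq> a"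
      using good_dom_least[OF D finite_fset t(2,3)] by blast
    then have "Num n \<in> app G c" using t(4) by simp
    then obtain Y m where "Num n = Num m" "fset Y \<subseteq> c" "Arr Y m \<in> G" by (rule app_E)
    then have Y: "fset Y \<subseteq> c" "Arr Y n \<in> G" by auto
    then obtain f where f: "enc D f \<in> S" "Arr Y n \<in> enc D f" using loc by blast
    have "f a = {Num n}" if "a \<in> D" "fset X \<subseteq> a" for a
      using enc_D[OF f(2) that(1)] Y(1) c(3)[OF that] by blast
    then have "t \<in> enc D f" unfolding t(1) by (rule enc_I[OF t(2,3)])
    then show "t \<in> G" using f(1) unfolding G_def by blast
  qed
  then show "\<Union>S \<in> enc D ` scott_maps D" using sc unfolding G_def by (rule image_eqI)
next
  fix X assume X: "finite X \<and> (\<exists>a\<in>enc D ` scott_maps D. X \<subseteq> a)"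
  then obtain f where f: "f \<in> scott_maps D" "X \<subseteq> enc D f" by blast
  have sub: "app X a \<subseteq> g a" if "a \<in> D" "X \<subseteq> enc D g" for a g
  proof
    fix t assume "t \<in> app X a"
    then obtain Y n where Y: "t = Num n" "fset Y \<subseteq> a" "Arr Y n \<in> X" by (rule app_E)
    then have "g a = {Num n}" using enc_D[of Y n D g a] that by blast
    then show "t \<in> g a" using Y by simp
  qed
  have nb: "app X a \<in> nat_bot" if a: "a \<in> D" for a
    using sub[OF a f(2)] scott_map_nat_bot[OF f(1) a]
    by (auto simp: nat_bot_def dest!: subset_singletonD)
  have sc: "app X \<in> scott_maps D" using app_scott_map[OF D nb] .
  have "X \<subseteq> enc D (app X)"
  proof
    fix t assume t: "t \<in> X"
    then have "t \<in> enc D f" using f by blast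
    then obtain Y n c where Y: "t = Arr Y n" "c \<in> D" "fset Y \<subseteq> c"
      "\<forall>a\<in>D. fset Y \<subseteq> a \<longrightarrow> f a = {Num n}" by (rule enc_E)
    have "app X a = {Num n}" if "a \<in> D" "fset Y \<subseteq> a" for a
      using nat_bot_eqI[OF nb app_I] that t Y(1) by blast
    then show "t \<in> enc D (app X)" unfolding Y(1) by (rule enc_I[OF Y(2,3)])
  qed
  moreover have "enc D (app X) \<subseteq> a" if a: "a \<in> enc D ` scott_maps D" "X \<subseteq> a" for a
  proof -
    obtain g where g: "a = enc D g" "g \<in> scott_maps D" using a by blast
    then show ?thesis using enc_mono[OF D sc g(2)] sub a(2) by simp
  qed
  moreover have "enc D (app X) \<in> enc D ` scott_maps D" using sc by (rule imageI)
  ultimately show "\<exists>c\<in>enc D ` scott_maps D. X \<subseteq> c \<and> (\<forall>a\<in>enc D ` scott_maps D. X \<subseteq> a \<longrightarrow> c \<subseteq> a)"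
    by metis
qed

lemma good_dom_pdom: "good_dom (pdom k)"
  by (induction k) (simp_all add: good_dom_nat_bot good_dom_enc)

lemma pdom_Suc_order:
  assumes "F \<in> pdom (Suc k)" "G \<in> pdom (Suc k)"
  shows "F \<subseteq> G \<longleftrightarrow> (\<forall>a\<in>pdom k. app F a \<subseteq> app G a)"
proof -
  obtain f g where fg: "F = enc (pdom k) f" "G = enc (pdom k) g"
      "f \<in> scott_maps (pdom k)" "g \<in> scott_maps (pdom k)" using assms by auto
  then show ?thesis
    using enc_mono[OF good_dom_pdom fg(3,4)] app_enc[OF good_dom_pdom] by simp
qed

lemma pdom_Suc_bij:
  "bij_betw (\<lambda>F. restrict (app F) (pdom k)) (pdom (Suc k))
     {f \<in> extensional (pdom k).
        continuous_map (scott_topology (pdom k)) (scott_topology (pdom 0)) f}"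
  unfolding bij_betw_def
proof
  let ?D = "pdom k"
  show "inj_on (\<lambda>F. restrict (app F) ?D) (pdom (Suc k))"
  proof (rule inj_onI)
    fix F G assume FG: "F \<in> pdom (Suc k)" "G \<in> pdom (Suc k)"
      and eq: "restrict (app F) ?D = restrict (app G) ?D"
    have "app F a = app G a" if "a \<in> ?D" for a using fun_cong[OF eq, of a] that by simp
    then show "F = G" using pdom_Suc_order[OF FG] pdom_Suc_order[OF FG(2,1)] by auto
  qed
  have cong: "g \<in> scott_maps ?D" if "f \<in> scott_maps ?D" "\<And>a. a \<in> ?D \<Longrightarrow> g a = f a" for f g
    using that continuous_map_eq[of "scott_topology ?D" "scott_topology nat_bot" f g] by simp
  show "(\<lambda>F. restrict (app F) ?D) ` pdom (Suc k) =
      {f \<in> extensional ?D. continuous_map (scott_topology ?D) (scott_topology (pdom 0)) f}"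
  proof (intro set_eqI iffI)
    fix h assume "h \<in> (\<lambda>F. restrict (app F) ?D) ` pdom (Suc k)"
    then obtain f where f: "f \<in> scott_maps ?D" "h = restrict (app (enc ?D f)) ?D" by auto
    then have "h \<in> scott_maps ?D"
      by (intro cong[OF f(1)]) (simp add: app_enc[OF good_dom_pdom])
    then show "h \<in> {f \<in> extensional ?D. continuous_map (scott_topology ?D) (scott_topology (pdom 0)) f}"
      using f by simp
  next
    fix h
    assume h: "h \<in> {f \<in> extensional ?D. continuous_map (scott_topology ?D) (scott_topology (pdom 0)) f}"
    then have h': "h \<in> scott_maps ?D" "h \<in> extensional ?D" by auto
    have "h = restrict (app (enc ?D h)) ?D"
    proof
      fix a show "h a = restrict (app (enc ?D h)) ?D a"
        using h' app_enc[OF good_dom_pdom h'(1)] by (cases "a \<in> ?D") (auto simp: extensional_def)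
    qed
    moreover have "enc ?D h \<in> pdom (Suc k)" using h'(1) by simp
    ultimately show "h \<in> (\<lambda>F. restrict (app F) ?D) ` pdom (Suc k)" by blast
  qed
qed


section \<open>The Kleene--Kreisel continuous functionals\<close>

definition num_eq :: "tok set \<Rightarrow> tok set \<Rightarrow> bool" where
  "num_eq x y \<longleftrightarrow> (\<exists>n. x = {Num n} \<and> y = {Num n})"

primrec total_eq :: "nat \<Rightarrow> tok set \<Rightarrow> tok set \<Rightarrow> bool" where
  "total_eq 0 = num_eq"
| "total_eq (Suc k) = (\<lambda>f g. f \<in> pdom (Suc k) \<and> g \<in> pdom (Suc k) \<and>
     (\<forall>a b. total_eq k a b \<longrightarrow> num_eq (app f a) (app g b)))"

definition total_elems :: "nat \<Rightarrow> tok set set" where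
  "total_elems k = {x. total_eq k x x}"

definition Ct :: "nat \<Rightarrow> tok set set topology" where
  "Ct k = quotient_topology (subtopology (scott_topology (pdom k)) (total_elems k))
            (\<lambda>x. {y. total_eq k x y})"

lemma total_eq_pdom: "total_eq k x y \<Longrightarrow> x \<in> pdom k \<and> y \<in> pdom k"
  by (cases k) (auto simp: num_eq_def nat_bot_def)

lemma num_eq_sym: "num_eq x y \<Longrightarrow> num_eq y x"
  by (auto simp: num_eq_def)

lemma num_eq_trans: "num_eq x y \<Longrightarrow> num_eq y z \<Longrightarrow> num_eq x z"
  by (auto simp: num_eq_def)

lemma total_eq_sym: "total_eq k x y \<Longrightarrow> total_eq k y x"
proof (induction k arbitrary: x y)
  case 0
  then show ?case by (auto simp: num_eq_def)
next
  case (Suc k)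
  have "num_eq (app y a) (app x b)" if "total_eq k a b" for a b
    using Suc.prems Suc.IH[OF that] num_eq_sym by (simp del: pdom.simps)
  then show ?case using Suc.prems by (simp del: pdom.simps)
qed

lemma total_eq_trans: "total_eq k x y \<Longrightarrow> total_eq k y z \<Longrightarrow> total_eq k x z"
proof (induction k arbitrary: x y z)
  case 0
  then show ?case by (auto simp: num_eq_def)
next
  case (Suc k)
  have "num_eq (app x a) (app z b)" if ab: "total_eq k a b" for a b
  proof -
    have "total_eq k b b" using Suc.IH[OF total_eq_sym[OF ab] ab] .
    then have "num_eq (app x a) (app y b)" "num_eq (app y b) (app z b)"
      using Suc.prems ab by (simp_all del: pdom.simps)
    then show ?thesis by (rule num_eq_trans)
  qed
  then show ?case using Suc.prems by (simp del: pdom.simps)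
qed

lemma topspace_Ct: "topspace (Ct k) = total_elems k // {(x, y). total_eq k x y}"
proof -
  have "total_elems k \<subseteq> pdom k" using total_eq_pdom by (auto simp: total_elems_def)
  then have "topspace (Ct k) = (\<lambda>x. {y. total_eq k x y}) ` total_elems k"
    by (simp add: Ct_def Int_absorb1)
  then show ?thesis by (auto simp: quotient_def Image_def)
qed

definition Pi01_tilde :: "'a topology \<Rightarrow> 'a set \<Rightarrow> bool" where
  "Pi01_tilde X A \<longleftrightarrow>
     (\<exists>C :: nat \<Rightarrow> 'a set. (\<forall>n. openin X (C n) \<and> closedin X (C n)) \<and> A = (\<Inter>n. C n))"


section \<open>Spaces of continuous functions\<close>

definition cfun :: "'a topology \<Rightarrow> 'b topology \<Rightarrow> ('a \<Rightarrow> 'b) set" where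
  "cfun X Y = {f \<in> extensional (topspace X). continuous_map X Y f}"

definition cont_conv ::
    "'a topology \<Rightarrow> 'b topology \<Rightarrow> (nat \<Rightarrow> 'a \<Rightarrow> 'b) \<Rightarrow> ('a \<Rightarrow> 'b) \<Rightarrow> bool" where
  "cont_conv X Y F f \<longleftrightarrow>
     (\<forall>a\<in>topspace X. \<forall>s. range s \<subseteq> topspace X \<and> limitin X s a sequentially \<longrightarrow>
        limitin Y (\<lambda>n. F n (s n)) (f a) sequentially)"

definition conv_topology :: "'a topology \<Rightarrow> 'b topology \<Rightarrow> ('a \<Rightarrow> 'b) topology \<Rightarrow> bool" where
  "conv_topology X Y T \<longleftrightarrow> topspace T = cfun X Y \<and>
     (\<forall>F f. range F \<subseteq> cfun X Y \<and> f \<in> cfun X Y \<longrightarrow>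
        (limitin T F f sequentially \<longleftrightarrow> cont_conv X Y F f))"

definition finest_conv_topology ::
    "'a topology \<Rightarrow> 'b topology \<Rightarrow> ('a \<Rightarrow> 'b) topology \<Rightarrow> bool" where
  "finest_conv_topology X Y T \<longleftrightarrow> conv_topology X Y T \<and>
     (\<forall>T'. conv_topology X Y T' \<longrightarrow> (\<forall>U. openin T' U \<longrightarrow> openin T U))"

text \<open>Existence and uniqueness of this topology are proved in \<open>finest_conv_topology_cfun_topology\<close>
  and \<open>finest_conv_topology_unique\<close>.\<close>

definition cfun_topology :: "'a topology \<Rightarrow> 'b topology \<Rightarrow> ('a \<Rightarrow> 'b) topology" where
  "cfun_topology X Y = (THE T. finest_conv_topology X Y T)"

lemma finest_conv_topology_unique:
  "finest_conv_topology X Y T \<Longrightarrow> finest_conv_topology X Y T' \<Longrightarrow> T = T'"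
  unfolding finest_conv_topology_def topology_eq by blast

definition cc_seq_open :: "'a topology \<Rightarrow> 'b topology \<Rightarrow> ('a \<Rightarrow> 'b) set \<Rightarrow> bool" where
  "cc_seq_open X Y U \<longleftrightarrow> U \<subseteq> cfun X Y \<and>
     (\<forall>F f. range F \<subseteq> cfun X Y \<and> f \<in> U \<and> cont_conv X Y F f \<longrightarrow>
        (\<forall>\<^sub>F n in sequentially. F n \<in> U))"

lemma cc_seq_openD:
  "cc_seq_open X Y U \<Longrightarrow> range F \<subseteq> cfun X Y \<Longrightarrow> f \<in> U \<Longrightarrow> cont_conv X Y F f \<Longrightarrow>
     \<forall>\<^sub>F n in sequentially. F n \<in> U"
  unfolding cc_seq_open_def by metis

lemma istopology_cc_seq_open: "istopology (cc_seq_open X Y)"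
  unfolding istopology_def
proof (intro conjI allI impI)
  fix U V assume U: "cc_seq_open X Y U" and V: "cc_seq_open X Y V"
  show "cc_seq_open X Y (U \<inter> V)"
    unfolding cc_seq_open_def
  proof (intro conjI allI impI)
    show "U \<inter> V \<subseteq> cfun X Y" using U by (auto simp: cc_seq_open_def)
    fix F f assume *: "range F \<subseteq> cfun X Y \<and> f \<in> U \<inter> V \<and> cont_conv X Y F f"
    have "\<forall>\<^sub>F n in sequentially. F n \<in> U" "\<forall>\<^sub>F n in sequentially. F n \<in> V"
      using cc_seq_openD[OF U, of F f] cc_seq_openD[OF V, of F f] * by auto
    then show "\<forall>\<^sub>F n in sequentially. F n \<in> U \<inter> V" by eventually_elim simp
  qed
next
  fix \<U> assume U: "\<forall>U\<in>\<U>. cc_seq_open X Y U"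
  show "cc_seq_open X Y (\<Union>\<U>)"
    unfolding cc_seq_open_def
  proof (intro conjI allI impI)
    show "\<Union>\<U> \<subseteq> cfun X Y" using U by (auto simp: cc_seq_open_def)
    fix F f assume *: "range F \<subseteq> cfun X Y \<and> f \<in> \<Union>\<U> \<and> cont_conv X Y F f"
    then obtain V where V: "V \<in> \<U>" "f \<in> V" by blast
    then have "\<forall>\<^sub>F n in sequentially. F n \<in> V" using cc_seq_openD[of X Y V F f] U * by auto
    then show "\<forall>\<^sub>F n in sequentially. F n \<in> \<Union>\<U>"
      by (rule eventually_mono) (use V in auto)
  qed
qed

lemma convergent_sequence_compact:
  assumes s: "limitin X s a sequentially" and sX: "range s \<subseteq> topspace X"
    and x: "\<And>j::nat. x j \<in> insert a (s ` {N..})"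
  shows "\<exists>r b. strict_mono (r::nat \<Rightarrow> nat) \<and> b \<in> insert a (s ` {N..}) \<and>
           limitin X (x \<circ> r) b sequentially"
proof (cases "\<exists>b\<in>insert a (s ` {N..}). infinite {j. x j = b}")
  case True
  then obtain b where b: "b \<in> insert a (s ` {N..})" "infinite {j. x j = b}" by blast
  then obtain r :: "nat \<Rightarrow> nat" where r: "strict_mono r" "\<And>n. r n \<in> {j. x j = b}"
    using infinite_enumerate by blast
  have "b \<in> topspace X" using b s sX by (auto simp: limitin_def)
  then have "limitin X (x \<circ> r) b sequentially" using r by (auto simp: limitin_def)
  then show ?thesis using r b by blast
next
  case False
  then have fin: "finite {j. x j = b}" if "b \<in> insert a (s ` {N..})" for b
    using that by blast
  have "limitin X x a sequentially"
    unfolding limitin_def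
  proof (intro conjI allI impI)
    show a: "a \<in> topspace X" using s by (simp add: limitin_def)
    fix U assume U: "openin X U \<and> a \<in> U"
    then obtain M where M: "\<And>n. n \<ge> M \<Longrightarrow> s n \<in> U"
      using s unfolding limitin_def eventually_sequentially by blast
    have "{j. x j \<notin> U} \<subseteq> (\<Union>b\<in>s ` {N..<M}. {j. x j = b})"
    proof
      fix j assume "j \<in> {j. x j \<notin> U}"
      then have "x j \<notin> U" by simp
      moreover from this obtain n where "n \<ge> N" "x j = s n" using x[of j] U by auto
      ultimately show "j \<in> (\<Union>b\<in>s ` {N..<M}. {j. x j = b})"
        using M[of n] by (cases "n < M") auto
    qed
    moreover have "finite (\<Union>b\<in>s ` {N..<M}. {j. x j = b})" using fin by auto
    ultimately have "finite {j. x j \<notin> U}" by (rule finite_subset)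
    then have "\<forall>\<^sub>F j in cofinite. x j \<in> U" by (simp add: eventually_cofinite)
    then show "\<forall>\<^sub>F j in sequentially. x j \<in> U" by (simp add: cofinite_eq_sequentially)
  qed
  then have "limitin X (x \<circ> id) a sequentially" by simp
  then show ?thesis using strict_mono_id by blast
qed

lemma cc_seq_open_compact_open:
  assumes s: "limitin X s a sequentially" "range s \<subseteq> topspace X" and V: "openin Y V"
  shows "cc_seq_open X Y {f \<in> cfun X Y. f ` insert a (s ` {N..}) \<subseteq> V}" (is "cc_seq_open X Y ?U")
  unfolding cc_seq_open_def
proof (intro conjI allI impI)
  let ?K = "insert a (s ` {N..})"
  have KX: "?K \<subseteq> topspace X" using s by (auto simp: limitin_def)
  fix F f assume *: "range F \<subseteq> cfun X Y \<and> f \<in> ?U \<and> cont_conv X Y F f"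
  show "\<forall>\<^sub>F n in sequentially. F n \<in> ?U"
  proof (rule ccontr)
    assume "\<not> ?thesis"
    then have "infinite {n. F n \<notin> ?U}"
      by (simp add: eventually_cofinite flip: cofinite_eq_sequentially)
    then obtain r :: "nat \<Rightarrow> nat" where r: "strict_mono r" "\<And>n. r n \<in> {n. F n \<notin> ?U}"
      using infinite_enumerate by blast
    have "\<exists>x\<in>?K. F (r j) x \<notin> V" for j using r(2)[of j] * by blast
    then obtain x where x: "\<And>j. x j \<in> ?K" "\<And>j. F (r j) (x j) \<notin> V" by metis
    have "\<exists>r b. strict_mono (r :: nat \<Rightarrow> nat) \<and> b \<in> ?K \<and> limitin X (x \<circ> r) b sequentially"
      by (rule convergent_sequence_compact[OF s]) (rule x(1))
    then obtain q b where q: "strict_mono (q :: nat \<Rightarrow> nat)" "b \<in> ?K"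
        "limitin X (x \<circ> q) b sequentially"
      by (elim exE conjE)
    define p where "p = r \<circ> q"
    have p: "strict_mono p" using r q by (simp add: p_def strict_mono_o)
    define t where "t = (\<lambda>n. if n \<in> range p then x (q (inv p n)) else b)"
    have tp: "t (p j) = x (q j)" for j
      using strict_mono_imp_inj_on[OF p] by (simp add: t_def)
    have "limitin X t b sequentially"
      unfolding limitin_def
    proof (intro conjI allI impI)
      show "b \<in> topspace X" using q KX by blast
      fix W assume W: "openin X W \<and> b \<in> W"
      then obtain M where M: "\<And>j. j \<ge> M \<Longrightarrow> x (q j) \<in> W"
        using q(3) unfolding limitin_def eventually_sequentially by auto
      have "t n \<in> W" if "n \<ge> p M" for n
      proof (cases "n \<in> range p")
        case True
        then obtain j where j: "n = p j" by blast
        then have "j \<ge> M" using that p by (simp add: strict_mono_less_eq)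
        then show ?thesis using M tp j by simp
      qed (use W in \<open>simp add: t_def\<close>)
      then show "\<forall>\<^sub>F n in sequentially. t n \<in> W" unfolding eventually_sequentially by blast
    qed
    moreover have "range t \<subseteq> topspace X" 
      using subsetD[OF KX x(1)] subsetD[OF KX q(2)] by (auto simp: t_def)
    ultimately have "limitin Y (\<lambda>n. F n (t n)) (f b) sequentially"
      using * q(2) KX unfolding cont_conv_def by blast
    moreover have "f b \<in> V" using * q(2) by blast
    ultimately have "\<forall>\<^sub>F n in sequentially. F n (t n) \<in> V" using V by (auto simp: limitin_def)
    then obtain M where "\<And>n. n \<ge> M \<Longrightarrow> F n (t n) \<in> V" unfolding eventually_sequentially by blast
    then have "F (p M) (t (p M)) \<in> V" using p by (simp add: strict_mono_imp_increasing)
    then show False using x(2)[of "q M"] tp by (simp add: p_def)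
  qed
qed blast

lemma finest_conv_topology_cc_seq_open: "finest_conv_topology X Y (topology (cc_seq_open X Y))"
proof -
  let ?T = "topology (cc_seq_open X Y)"
  have op: "openin ?T U \<longleftrightarrow> cc_seq_open X Y U" for U
    by (simp add: istopology_cc_seq_open)
  have "cc_seq_open X Y (cfun X Y)"
    unfolding cc_seq_open_def by (auto intro!: always_eventually)
  then have top: "topspace ?T = cfun X Y"
    unfolding topspace_def op by (auto simp: cc_seq_open_def)
  have "limitin ?T F f sequentially \<longleftrightarrow> cont_conv X Y F f"
    if F: "range F \<subseteq> cfun X Y" and f: "f \<in> cfun X Y" for F f
  proof
    assume "cont_conv X Y F f"
    then show "limitin ?T F f sequentially"
      using F f unfolding limitin_def top op cc_seq_open_def by blast
  next
    assume L: "limitin ?T F f sequentially"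
    show "cont_conv X Y F f"
      unfolding cont_conv_def
    proof (intro ballI allI impI)
      fix a s assume a: "a \<in> topspace X" and s: "range s \<subseteq> topspace X \<and> limitin X s a sequentially"
      have fc: "continuous_map X Y f" using f by (simp add: cfun_def)
      then have lim: "limitin Y (f \<circ> s) (f a) sequentially"
        using continuous_map_limit[OF fc, of s a sequentially] s by simp
      show "limitin Y (\<lambda>n. F n (s n)) (f a) sequentially"
        unfolding limitin_def
      proof (intro conjI allI impI)
        show "f a \<in> topspace Y" using lim by (simp add: limitin_def)
        fix V assume V: "openin Y V \<and> f a \<in> V"
        then obtain N where N: "\<And>n. n \<ge> N \<Longrightarrow> f (s n) \<in> V"
          using lim unfolding limitin_def eventually_sequentially by auto
        let ?U = "{f \<in> cfun X Y. f ` insert a (s ` {N..}) \<subseteq> V}"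
        have "openin ?T ?U" unfolding op by (rule cc_seq_open_compact_open) (use s V in auto)
        moreover have "f \<in> ?U" using f N V by auto
        ultimately have ev: "\<forall>\<^sub>F n in sequentially. F n \<in> ?U" by (rule limitinD[OF L])
        show "\<forall>\<^sub>F n in sequentially. F n (s n) \<in> V"
          using ev eventually_ge_at_top[of N] by eventually_elim auto
      qed
    qed
  qed
  then have conv: "conv_topology X Y ?T" using top unfolding conv_topology_def by blast
  have "openin ?T U" if T': "conv_topology X Y T'" and U: "openin T' U" for T' U
    unfolding op cc_seq_open_def
  proof (intro conjI allI impI)
    show U': "U \<subseteq> cfun X Y" using T' openin_subset[OF U] by (simp add: conv_topology_def)
    fix F f assume *: "range F \<subseteq> cfun X Y \<and> f \<in> U \<and> cont_conv X Y F f"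
    then have "limitin T' F f sequentially" using T' U' unfolding conv_topology_def by blast
    then show "\<forall>\<^sub>F n in sequentially. F n \<in> U" using U * by (auto simp: limitin_def)
  qed
  then show ?thesis using conv unfolding finest_conv_topology_def by blast
qed

lemma finest_conv_topology_cfun_topology: "finest_conv_topology X Y (cfun_topology X Y)"
  unfolding cfun_topology_def
  by (rule theI[of "finest_conv_topology X Y", OF finest_conv_topology_cc_seq_open])
    (rule finest_conv_topology_unique[OF _ finest_conv_topology_cc_seq_open])

lemma topspace_cfun_topology [simp]: "topspace (cfun_topology X Y) = cfun X Y"
  using finest_conv_topology_cfun_topology[of X Y]
  unfolding finest_conv_topology_def conv_topology_def by (elim conjE)

end

theory Submission
  imports Defs
begin

text \<open>
  Write \<open>A\<close> as the intersection of clopen sets \<open>C n\<close>. Outside \<open>A\<close> put \<open>g x = f\<^sub>n x\<close>, where \<open>n\<close> is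
  least with \<open>x \<notin> C n\<close> and \<open>f\<^sub>n\<close> is a continuous function on the whole space that depends
  continuously on finitely many values of \<open>f\<close>. It suffices that \<open>f\<^sub>n(x\<^sub>n)\<close> tends to \<open>f x\<close>
  whenever \<open>x\<^sub>n\<close> tends to \<open>x \<in> A\<close>, uniformly along convergent sequences of functions \<open>f\<close>.

  To get \<open>f\<^sub>n\<close>, sample \<open>f\<close> at one element of \<open>A\<close> for each finite piece of information \<open>s i\<close>
  realised in \<open>A\<close>. Discard \<open>i\<close> as soon as two samples refining \<open>s i\<close> differ, and let \<open>f\<^sub>n x\<close> be the
  sample of the first undiscarded \<open>i \<le> n\<close> which \<open>x\<close> does not visibly contradict. If \<open>s i\<close> is
  consistent with a total \<open>x \<in> A\<close>, then their join represents the same element of \<open>A\<close>, so the sample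
  of \<open>i\<close> is either close to \<open>f x\<close> or eventually discarded. If it is inconsistent with \<open>x\<close>, this
  is witnessed by a finite part of \<open>x\<close> and, by the density theorem, by a clopen set. For real values
  the discrete choice is smoothed by a partition of unity over the possible patterns of closeness of
  the samples.
\<close>

section \<open>The topology of the continuous functionals\<close>

instance tok :: countable
  by countable_datatype

definition cls :: "nat \<Rightarrow> tok set \<Rightarrow> tok set set" where
  "cls k x = {y. total_eq k x y}"

definition consistent :: "nat \<Rightarrow> tok set \<Rightarrow> bool" where
  "consistent k X \<longleftrightarrow> (\<exists>a\<in>pdom k. X \<subseteq> a)"

text \<open>Neighbourhoods are taken at representatives in \<open>N(k)\<close>, where finite pieces of information
  form a countable base; the image in \<open>Ct k\<close> of such a basic set is in general not open.\<close>

definition nhds_total :: "nat \<Rightarrow> tok set \<Rightarrow> tok set filter" where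
  "nhds_total k x = (INF \<sigma>\<in>{\<sigma>. finite \<sigma> \<and> \<sigma> \<subseteq> x}. principal {y \<in> total_elems k. \<sigma> \<subseteq> y})"

lemma eventually_nhds_total:
  "eventually P (nhds_total k x) \<longleftrightarrow>
     (\<exists>\<sigma>. finite \<sigma> \<and> \<sigma> \<subseteq> x \<and> (\<forall>y\<in>total_elems k. \<sigma> \<subseteq> y \<longrightarrow> P y))"
proof -
  have "eventually P (nhds_total k x) \<longleftrightarrow>
      (\<exists>\<sigma>\<in>{\<sigma>. finite \<sigma> \<and> \<sigma> \<subseteq> x}. eventually P (principal {y \<in> total_elems k. \<sigma> \<subseteq> y}))"
    unfolding nhds_total_def
  proof (rule eventually_INF_base)
    show "{\<sigma>. finite \<sigma> \<and> \<sigma> \<subseteq> x} \<noteq> {}" by blast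
    fix a b assume "a \<in> {\<sigma>. finite \<sigma> \<and> \<sigma> \<subseteq> x}" "b \<in> {\<sigma>. finite \<sigma> \<and> \<sigma> \<subseteq> x}"
    then show "\<exists>c\<in>{\<sigma>. finite \<sigma> \<and> \<sigma> \<subseteq> x}. principal {y \<in> total_elems k. c \<subseteq> y} \<le>
        inf (principal {y \<in> total_elems k. a \<subseteq> y}) (principal {y \<in> total_elems k. b \<subseteq> y})"
      by (intro bexI[of _ "a \<union> b"]) auto
  qed
  then show ?thesis by (auto simp: eventually_principal)
qed

lemma eventually_nhds_total_I:
  "finite \<sigma> \<Longrightarrow> \<sigma> \<subseteq> x \<Longrightarrow> (\<And>y. y \<in> total_elems k \<Longrightarrow> \<sigma> \<subseteq> y \<Longrightarrow> P y) \<Longrightarrow> eventually P (nhds_total k x)"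
  by (auto simp: eventually_nhds_total)

lemma eventually_nhds_total_self: "eventually P (nhds_total k x) \<Longrightarrow> x \<in> total_elems k \<Longrightarrow> P x"
  by (auto simp: eventually_nhds_total)

lemma total_elems_pdom: "x \<in> total_elems k \<Longrightarrow> x \<in> pdom k"
  using total_eq_pdom by (auto simp: total_elems_def)

lemma eventually_nhds_total_total_elems: "eventually (\<lambda>y. y \<in> total_elems k) (nhds_total k x)"
  by (rule eventually_nhds_total_I[of "{}"]) auto

lemma cls_eq_iff: "x \<in> total_elems k \<Longrightarrow> cls k x = cls k y \<longleftrightarrow> total_eq k x y"
proof
  assume "x \<in> total_elems k" "cls k x = cls k y"
  then have "x \<in> cls k y" by (auto simp: cls_def total_elems_def)
  then show "total_eq k x y" by (auto simp: cls_def intro: total_eq_sym)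
next
  assume "total_eq k x y"
  then show "cls k x = cls k y"
    unfolding cls_def by (blast intro: total_eq_sym total_eq_trans)
qed

lemma topspace_Ct_cls: "topspace (Ct k) = cls k ` total_elems k"
  unfolding topspace_Ct by (auto simp: quotient_def Image_def cls_def)

lemma cls_in_Ct [simp]: "x \<in> total_elems k \<Longrightarrow> cls k x \<in> topspace (Ct k)"
  by (simp add: topspace_Ct_cls)

lemma app_nat_bot: "F \<in> pdom (Suc k) \<Longrightarrow> a \<in> pdom k \<Longrightarrow> app F a \<in> nat_bot"
  using app_enc[OF good_dom_pdom, of _ k a] scott_map_nat_bot[of _ "pdom k" a] by auto

definition least_above :: "'a set set \<Rightarrow> 'a set \<Rightarrow> 'a set \<Rightarrow> bool" where
  "least_above D X c \<longleftrightarrow> c \<in> D \<and> X \<subseteq> c \<and> (\<forall>b\<in>D. X \<subseteq> b \<longrightarrow> c \<subseteq> b)"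

lemma least_aboveD:
  assumes "least_above D X c"
  shows "c \<in> D" "X \<subseteq> c" "\<And>b. b \<in> D \<Longrightarrow> X \<subseteq> b \<Longrightarrow> c \<subseteq> b"
  using assms by (auto simp: least_above_def)

lemma least_above_ex:
  assumes "good_dom D" "finite X" "a \<in> D" "X \<subseteq> a"
  shows "\<exists>c. least_above D X c"
  using assms unfolding good_dom_def least_above_def by meson

text \<open>The least element above \<open>s \<union> (\<sigma> \<union> \<tau>)\<close> bounds
  those above \<open>s \<union> \<sigma>\<close> and \<open>s \<union> \<tau>\<close>. Empty
  \<open>s\<close> recovers a point from its finite parts; general \<open>s\<close> gives
  compactness of consistency.\<close>

lemma directed_least_elements:
  assumes D: "good_dom D" and cons: "\<And>\<sigma>. finite \<sigma> \<Longrightarrow> \<sigma> \<subseteq> x \<Longrightarrow> \<exists>a\<in>D. s \<union> \<sigma> \<subseteq> a"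
    and s: "finite s"
  defines "S \<equiv> {c. \<exists>\<sigma>. finite \<sigma> \<and> \<sigma> \<subseteq> x \<and> least_above D (s \<union> \<sigma>) c}"
  shows "directed_set S" "s \<union> x \<subseteq> \<Union>S"
proof -
  have ex: "\<exists>c\<in>S. least_above D (s \<union> \<sigma>) c" if \<sigma>: "finite \<sigma>" "\<sigma> \<subseteq> x" for \<sigma>
  proof -
    obtain a where a: "a \<in> D" "s \<union> \<sigma> \<subseteq> a" using cons[OF \<sigma>] ..
    have fin: "finite (s \<union> \<sigma>)" using s \<sigma> by simp
    obtain c where "least_above D (s \<union> \<sigma>) c" using least_above_ex[OF D fin a] ..
    then show ?thesis unfolding S_def using \<sigma> by blast
  qed
  show "directed_set S"
    unfolding directed_set_def
  proof (intro conjI ballI)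
    show "S \<noteq> {}" using ex[of "{}"] by blast
    fix c d assume "c \<in> S" "d \<in> S"
    then obtain \<sigma> \<tau> where \<sigma>: "finite \<sigma>" "\<sigma> \<subseteq> x" "least_above D (s \<union> \<sigma>) c"
      and \<tau>: "finite \<tau>" "\<tau> \<subseteq> x" "least_above D (s \<union> \<tau>) d" unfolding S_def by blast
    then have "finite (\<sigma> \<union> \<tau>)" "\<sigma> \<union> \<tau> \<subseteq> x" by auto
    then obtain e where e: "e \<in> S" "least_above D (s \<union> (\<sigma> \<union> \<tau>)) e" using ex by blast
    have "c \<subseteq> e" "d \<subseteq> e"
      using least_aboveD(1,2)[OF e(2)] least_aboveD(3)[OF \<sigma>(3)] least_aboveD(3)[OF \<tau>(3)] by auto
    then show "\<exists>z\<in>S. c \<subseteq> z \<and> d \<subseteq> z" using e(1) by blast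
  qed
  show "s \<union> x \<subseteq> \<Union>S"
  proof
    fix t assume t: "t \<in> s \<union> x"
    \<comment> \<open>Intersecting with \<open>x\<close> treats both cases at once: a token of
      \<open>s\<close> may lie outside \<open>x\<close>.\<close>
    have "finite ({t} \<inter> x)" "{t} \<inter> x \<subseteq> x" by auto
    then obtain c where c: "c \<in> S" "least_above D (s \<union> ({t} \<inter> x)) c" using ex by blast
    then have "t \<in> c" using t least_aboveD(2)[OF c(2)] by auto
    then show "t \<in> \<Union>S" using c(1) by blast
  qed
qed

lemma scott_open_upper_finite:
  assumes D: "good_dom D" and "finite \<sigma>"
  shows "scott_open D {b \<in> D. \<sigma> \<subseteq> b}"
  unfolding scott_open_def
proof (intro conjI allI impI)
  fix S s assume *: "S \<subseteq> D \<and> directed_set S \<and> is_lub_in D S s \<and> s \<in> {b \<in> D. \<sigma> \<subseteq> b}"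
  have "\<Union>S \<in> D" using good_dom_Union[OF D] * by auto
  then have "s \<subseteq> \<Union>S" using * by (auto simp: is_lub_in_def)
  then have "\<sigma> \<subseteq> \<Union>S" using * by auto
  then obtain b where "b \<in> S" "\<sigma> \<subseteq> b"
    using finite_subset_directed_Union[of \<sigma> S] * \<open>finite \<sigma>\<close> by blast
  then show "S \<inter> {b \<in> D. \<sigma> \<subseteq> b} \<noteq> {}" using * by auto
qed auto

text \<open>\<open>x\<close> is the supremum of the least elements above its finite parts, and a
  Scott open set containing a directed supremum meets the directed set.\<close>

lemma scott_open_finite_nbhd:
  assumes D: "good_dom D" and U: "scott_open D U" and x: "x \<in> U"
  obtains \<sigma> where "finite \<sigma>" "\<sigma> \<subseteq> x" "\<And>y. y \<in> D \<Longrightarrow> \<sigma> \<subseteq> y \<Longrightarrow> y \<in> U"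
proof -
  have xD: "x \<in> D" using U x by (auto simp: scott_open_def)
  define S where "S = {c. \<exists>\<sigma>. finite \<sigma> \<and> \<sigma> \<subseteq> x \<and> least_above D ({} \<union> \<sigma>) c}"
  have cons: "\<exists>a\<in>D. {} \<union> \<sigma> \<subseteq> a" if "\<sigma> \<subseteq> x" for \<sigma> using that xD by auto
  have dir: "directed_set S" "{} \<union> x \<subseteq> \<Union>S"
    unfolding S_def by (rule directed_least_elements[OF D]; use cons in simp)+
  have S: "c \<in> D \<and> c \<subseteq> x" if "c \<in> S" for c
    using that xD by (auto simp: S_def least_above_def)
  moreover have "x \<subseteq> u" if "\<forall>c\<in>S. c \<subseteq> u" for u using dir(2) that by blast
  ultimately have "is_lub_in D S x" unfolding is_lub_in_def using xD by simp
  then obtain c where c: "c \<in> S" "c \<in> U"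
    using scott_open_sup[OF U _ dir(1) _ x] S by auto
  then obtain \<sigma> where \<sigma>: "finite \<sigma>" "\<sigma> \<subseteq> x" "least_above D \<sigma> c" by (auto simp: S_def)
  show thesis
    using that[OF \<sigma>(1,2)] scott_open_up[OF U c(2)] least_aboveD(3)[OF \<sigma>(3)] by blast
qed

text \<open>The least common realisations of \<open>s\<close> and the finite parts of
  \<open>x\<close> are directed, so their union stays in the domain. Hence inconsistency with a
  point always has a finite witness.\<close>

lemma consistent_compactness:
  assumes s: "finite s" and cons: "\<And>\<sigma>. finite \<sigma> \<Longrightarrow> \<sigma> \<subseteq> x \<Longrightarrow> consistent k (s \<union> \<sigma>)"
  shows "consistent k (s \<union> x)"
proof -
  define S where "S = {c. \<exists>\<sigma>. finite \<sigma> \<and> \<sigma> \<subseteq> x \<and> least_above (pdom k) (s \<union> \<sigma>) c}"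
  have dir: "directed_set S" "s \<union> x \<subseteq> \<Union>S"
    unfolding S_def
    by (rule directed_least_elements[OF good_dom_pdom _ s]; use cons in \<open>simp add: consistent_def\<close>)+
  have "\<Union>S \<in> pdom k"
    by (rule good_dom_Union[OF good_dom_pdom _ dir(1)]) (auto simp: S_def least_above_def)
  then show ?thesis using dir(2) unfolding consistent_def by blast
qed

lemma openin_Ct_iff:
  "openin (Ct k) V \<longleftrightarrow> V \<subseteq> topspace (Ct k) \<and>
     (\<forall>x\<in>total_elems k. cls k x \<in> V \<longrightarrow> (\<forall>\<^sub>F y in nhds_total k x. cls k y \<in> V))"
proof -
  let ?T = "total_elems k" and ?D = "pdom k"
  have TD: "?D \<inter> ?T = ?T" using total_elems_pdom by blast
  have top: "topspace (subtopology (scott_topology ?D) ?T) = ?T" using TD by simp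
  have "openin (Ct k) V \<longleftrightarrow> V \<subseteq> topspace (Ct k) \<and>
      openin (subtopology (scott_topology ?D) ?T) {x \<in> ?T. cls k x \<in> V}"
    unfolding topspace_Ct_cls
    unfolding Ct_def openin_quotient_topology top cls_def ..
  also have "openin (subtopology (scott_topology ?D) ?T) {x \<in> ?T. cls k x \<in> V} \<longleftrightarrow>
      (\<forall>x\<in>?T. cls k x \<in> V \<longrightarrow> (\<forall>\<^sub>F y in nhds_total k x. cls k y \<in> V))" (is "?L \<longleftrightarrow> ?R")
  proof
    assume ?L
    then obtain U where U: "scott_open ?D U" "{x \<in> ?T. cls k x \<in> V} = U \<inter> ?T"
      by (auto simp: openin_subtopology openin_scott)
    show ?R
    proof (intro ballI impI)
      fix x assume "x \<in> ?T" "cls k x \<in> V"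
      then have "x \<in> U" using U by blast
      then obtain \<sigma> where \<sigma>: "finite \<sigma>" "\<sigma> \<subseteq> x" "\<And>y. y \<in> ?D \<Longrightarrow> \<sigma> \<subseteq> y \<Longrightarrow> y \<in> U"
        using scott_open_finite_nbhd[OF good_dom_pdom U(1)] by blast
      show "\<forall>\<^sub>F y in nhds_total k x. cls k y \<in> V"
        by (rule eventually_nhds_total_I[OF \<sigma>(1,2)]) (use \<sigma>(3) U(2) total_elems_pdom in blast)
    qed
  next
    assume R: ?R
    define \<S> where "\<S> = {\<sigma>. finite \<sigma> \<and> (\<forall>y\<in>?T. \<sigma> \<subseteq> y \<longrightarrow> cls k y \<in> V)}"
    have "openin (scott_topology ?D) (\<Union>\<sigma>\<in>\<S>. {b \<in> ?D. \<sigma> \<subseteq> b})"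
      by (rule openin_Union) (auto simp: \<S>_def openin_scott intro: scott_open_upper_finite good_dom_pdom)
    moreover have "{x \<in> ?T. cls k x \<in> V} = (\<Union>\<sigma>\<in>\<S>. {b \<in> ?D. \<sigma> \<subseteq> b}) \<inter> ?T"
    proof (intro set_eqI iffI)
      fix x assume "x \<in> {x \<in> ?T. cls k x \<in> V}"
      then obtain \<sigma> where "\<sigma> \<in> \<S>" "\<sigma> \<subseteq> x" "x \<in> ?T" using R by (auto simp: eventually_nhds_total \<S>_def)
      then show "x \<in> (\<Union>\<sigma>\<in>\<S>. {b \<in> ?D. \<sigma> \<subseteq> b}) \<inter> ?T" using total_elems_pdom by blast
    qed (auto simp: \<S>_def)
    ultimately show ?L by (auto simp: openin_subtopology)
  qed
  finally show ?thesis .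
qed

lemma eventually_nhds_total_clopen:
  assumes "openin (Ct k) B" "closedin (Ct k) B" "x \<in> total_elems k"
  shows "\<forall>\<^sub>F y in nhds_total k x. cls k y \<in> B \<longleftrightarrow> cls k x \<in> B"
proof (cases "cls k x \<in> B")
  case True
  then show ?thesis using assms(1,3) unfolding openin_Ct_iff by simp
next
  case False
  then have "openin (Ct k) (topspace (Ct k) - B)" using assms(2) by (simp add: closedin_def)
  then have "\<forall>\<^sub>F y in nhds_total k x. cls k y \<in> topspace (Ct k) - B"
    using False assms(3) unfolding openin_Ct_iff by simp
  then show ?thesis by (rule eventually_mono) (use False in simp)
qed

lemma clopen_Ct_I:
  assumes "\<And>x. x \<in> total_elems k \<Longrightarrow> \<forall>\<^sub>F y in nhds_total k x. P (cls k y) \<longleftrightarrow> P (cls k x)"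
  shows "openin (Ct k) {c \<in> topspace (Ct k). P c} \<and> closedin (Ct k) {c \<in> topspace (Ct k). P c}"
proof -
  have "openin (Ct k) {c \<in> topspace (Ct k). Q c}"
    if Q: "\<And>x. x \<in> total_elems k \<Longrightarrow> \<forall>\<^sub>F y in nhds_total k x. Q (cls k y) \<longleftrightarrow> Q (cls k x)" for Q
    unfolding openin_Ct_iff
  proof (intro conjI ballI impI)
    fix x assume x: "x \<in> total_elems k" "cls k x \<in> {c \<in> topspace (Ct k). Q c}"
    show "\<forall>\<^sub>F y in nhds_total k x. cls k y \<in> {c \<in> topspace (Ct k). Q c}"
      using Q[OF x(1)] eventually_nhds_total_total_elems by eventually_elim (use x in simp)
  qed auto
  note this[of P] this[of "\<lambda>c. \<not> P c"]
  moreover have "topspace (Ct k) - {c \<in> topspace (Ct k). P c} = {c \<in> topspace (Ct k). \<not> P c}" by auto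
  ultimately show ?thesis using assms by (auto simp: closedin_def)
qed

text \<open>Application is monotone and numerals are maximal in the flat domain, so enlarging a
  total element changes no value at a total argument. Joining consistent information to a
  representative therefore keeps its class.\<close>

lemma total_eq_superset:
  assumes "x \<in> total_elems k" "x \<subseteq> y" "y \<in> pdom k"
  shows "total_eq k x y"
proof (cases k)
  case 0
  then show ?thesis using assms by (auto simp: total_elems_def num_eq_def nat_bot_def)
next
  case (Suc j)
  have "num_eq (app x a) (app y b)" if ab: "total_eq j a b" for a b
  proof -
    have "num_eq (app x a) (app x b)" using assms(1) ab Suc by (simp add: total_elems_def)
    then obtain n where n: "app x a = {Num n}" "app x b = {Num n}" by (auto simp: num_eq_def)
    have "Num n \<in> app y b" using n(2) assms(2) unfolding app_def by blast
    moreover have "app y b \<in> nat_bot"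
      using app_nat_bot[of y j b] assms(3) Suc total_eq_pdom[OF ab] by simp
    ultimately have "app y b = {Num n}" by (rule nat_bot_eqI[rotated])
    then show ?thesis using n by (simp add: num_eq_def)
  qed
  then show ?thesis using assms total_elems_pdom[OF assms(1)] unfolding Suc by simp
qed


section \<open>Density and separation\<close>

lemma consistent_token:
  assumes "F \<in> pdom (Suc k)" "Arr X n \<in> F"
  shows "consistent k (fset X)" "\<And>a. a \<in> pdom k \<Longrightarrow> fset X \<subseteq> a \<Longrightarrow> app F a = {Num n}"
proof -
  obtain f where "F = enc (pdom k) f" using assms(1) by auto
  then show "consistent k (fset X)" using assms(2) by (auto simp: enc_def consistent_def)
  show "app F a = {Num n}" if "a \<in> pdom k" "fset X \<subseteq> a" for a
    using nat_bot_eqI[OF app_nat_bot[OF assms(1) that(1)] app_I[OF that(2) assms(2)]] .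
qed

lemma pdom_Suc_only_Arr:
  assumes "F \<in> pdom (Suc k)" "t \<in> F"
  obtains X n where "t = Arr X n"
  using assms by (auto simp: enc_def)

lemma enc_app_in_pdom:
  assumes "\<And>a. a \<in> pdom k \<Longrightarrow> app G a \<in> nat_bot"
  shows "enc (pdom k) (app G) \<in> pdom (Suc k)"
    "\<And>X n. Arr X n \<in> G \<Longrightarrow> consistent k (fset X) \<Longrightarrow> Arr X n \<in> enc (pdom k) (app G)"
    "\<And>a. a \<in> pdom k \<Longrightarrow> app (enc (pdom k) (app G)) a = app G a"
proof -
  have sc: "app G \<in> scott_maps (pdom k)" using app_scott_map[OF good_dom_pdom assms] .
  show "enc (pdom k) (app G) \<in> pdom (Suc k)" using sc by simp
  show "app (enc (pdom k) (app G)) a = app G a" if "a \<in> pdom k" for a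
    using app_enc[OF good_dom_pdom sc that] .
  fix X n assume X: "Arr X n \<in> G" "consistent k (fset X)"
  then obtain c where c: "c \<in> pdom k" "fset X \<subseteq> c" by (auto simp: consistent_def)
  show "Arr X n \<in> enc (pdom k) (app G)"
    by (rule enc_I[OF c]) (use nat_bot_eqI[OF assms app_I] X in blast)
qed

lemma app_nat_bot_I:
  assumes "\<And>X n Y m. Arr X n \<in> G \<Longrightarrow> Arr Y m \<in> G \<Longrightarrow> fset X \<subseteq> a \<Longrightarrow> fset Y \<subseteq> a \<Longrightarrow> n = m"
  shows "app G a \<in> nat_bot"
proof (cases "app G a = {}")
  case False
  then obtain X n where X: "fset X \<subseteq> a" "Arr X n \<in> G" by (auto simp: app_def)
  have "t = Num n" if "t \<in> app G a" for t
    using that assms[OF X(2) _ X(1)] by (auto simp: app_def)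
  then have "app G a = {Num n}" using app_I[OF X] by blast
  then show ?thesis by (simp add: nat_bot_def)
qed (simp add: nat_bot_def)

text \<open>Without such a conflict, \<open>\<sigma> \<union> \<tau>\<close> read as a graph would
  be single-valued at every argument, and the functional it defines would extend both sets.\<close>

lemma inconsistent_Suc_witness:
  assumes \<sigma>: "consistent (Suc k) \<sigma>" and \<tau>: "consistent (Suc k) \<tau>"
    and inc: "\<not> consistent (Suc k) (\<sigma> \<union> \<tau>)"
  obtains X n Y m where "Arr X n \<in> \<sigma>" "Arr Y m \<in> \<tau>" "n \<noteq> m" "consistent k (fset X \<union> fset Y)"
proof (rule ccontr)
  assume no: "\<not> thesis"
  obtain F where F: "F \<in> pdom (Suc k)" "\<sigma> \<subseteq> F" using \<sigma> unfolding consistent_def by blast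
  obtain H where H: "H \<in> pdom (Suc k)" "\<tau> \<subseteq> H" using \<tau> unfolding consistent_def by blast
  let ?G = "\<sigma> \<union> \<tau>"
  have cross: "n = m" if "Arr X n \<in> \<sigma>" "Arr Y m \<in> \<tau>" "a \<in> pdom k" "fset X \<subseteq> a" "fset Y \<subseteq> a"
    for X n Y m a
    using that no \<open>\<And>X n Y m. \<lbrakk>Arr X n \<in> \<sigma>; Arr Y m \<in> \<tau>; n \<noteq> m; consistent k (fset X \<union> fset Y)\<rbrakk> \<Longrightarrow> thesis\<close>
    unfolding consistent_def by (metis Un_least)
  have same: "n = m" if "E \<in> pdom (Suc k)" "Arr X n \<in> E" "Arr Y m \<in> E"
      "a \<in> pdom k" "fset X \<subseteq> a" "fset Y \<subseteq> a" for E X n Y m a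
    using consistent_token(2)[OF that(1,2,4,5)] consistent_token(2)[OF that(1,3,4,6)] by simp
  have nb: "app ?G a \<in> nat_bot" if a: "a \<in> pdom k" for a
  proof (rule app_nat_bot_I)
    fix X n Y m assume *: "Arr X n \<in> ?G" "Arr Y m \<in> ?G" "fset X \<subseteq> a" "fset Y \<subseteq> a"
    then consider "Arr X n \<in> \<sigma>" "Arr Y m \<in> \<sigma>" | "Arr X n \<in> \<tau>" "Arr Y m \<in> \<tau>"
      | "Arr X n \<in> \<sigma>" "Arr Y m \<in> \<tau>" | "Arr X n \<in> \<tau>" "Arr Y m \<in> \<sigma>" by blast
    then show "n = m"
    proof cases
      case 1 then show ?thesis using same[OF F(1) _ _ a *(3,4)] F(2) by blast
    next
      case 2 then show ?thesis using same[OF H(1) _ _ a *(3,4)] H(2) by blast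
    next
      case 3 then show ?thesis using cross[OF _ _ a *(3,4)] by blast
    next
      case 4 then show ?thesis using cross[OF _ _ a *(4,3)] by blast
    qed
  qed
  have "?G \<subseteq> enc (pdom k) (app ?G)"
  proof
    fix t assume t: "t \<in> ?G"
    obtain E where E: "E \<in> pdom (Suc k)" "t \<in> E" using t F H by blast
    obtain X n where X: "t = Arr X n" using pdom_Suc_only_Arr[OF E] .
    have "consistent k (fset X)" using consistent_token(1)[OF E(1)] E(2) X by simp
    then show "t \<in> enc (pdom k) (app ?G)" using enc_app_in_pdom(2)[OF nb] t X by blast
  qed
  then show False using inc enc_app_in_pdom(1)[OF nb] unfolding consistent_def by blast
qed

text \<open>The Kleene-Kreisel density theorem at type \<open>k\<close>, obtained by a joint
  induction with \<open>separated\<close>.\<close>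

definition dense_total :: "nat \<Rightarrow> bool" where
  "dense_total k \<longleftrightarrow> (\<forall>X. finite X \<and> consistent k X \<longrightarrow> (\<exists>z\<in>total_elems k. X \<subseteq> z))"

definition separated :: "nat \<Rightarrow> bool" where
  "separated k \<longleftrightarrow> (\<forall>\<sigma> \<tau>. finite \<sigma> \<and> finite \<tau> \<and> consistent k \<sigma> \<and> consistent k \<tau> \<and>
      \<not> consistent k (\<sigma> \<union> \<tau>) \<longrightarrow>
      (\<exists>B. openin (Ct k) B \<and> closedin (Ct k) B \<and>
         (\<forall>x\<in>total_elems k. (\<sigma> \<subseteq> x \<longrightarrow> cls k x \<in> B) \<and> (\<tau> \<subseteq> x \<longrightarrow> cls k x \<notin> B))))"

lemma total_elems_0: "total_elems 0 = range (\<lambda>n. {Num n})"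
  by (auto simp: total_elems_def num_eq_def)

lemma dense_total_0: "dense_total 0"
  unfolding dense_total_def total_elems_0 consistent_def by (auto simp: nat_bot_def)

lemma separated_0: "separated 0"
  unfolding separated_def
proof (intro allI impI)
  fix \<sigma> \<tau>
  assume *: "finite \<sigma> \<and> finite \<tau> \<and> consistent 0 \<sigma> \<and> consistent 0 \<tau> \<and> \<not> consistent 0 (\<sigma> \<union> \<tau>)"
  let ?P = "\<lambda>c. \<exists>x\<in>total_elems 0. c = cls 0 x \<and> \<sigma> \<subseteq> x"
  have P: "?P (cls 0 x) \<longleftrightarrow> \<sigma> \<subseteq> x" if "x \<in> total_elems 0" for x
  proof -
    have "x = y" if "cls 0 x = cls 0 y" for y
      using that cls_eq_iff[OF \<open>x \<in> total_elems 0\<close>, of y] by (auto simp: num_eq_def)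
    then show ?thesis using that by blast
  qed
  have "openin (Ct 0) {c \<in> topspace (Ct 0). ?P c} \<and> closedin (Ct 0) {c \<in> topspace (Ct 0). ?P c}"
  proof (rule clopen_Ct_I)
    fix x assume x: "x \<in> total_elems 0"
    then have "finite x" by (auto simp: total_elems_0)
    moreover have "y = x" if "y \<in> total_elems 0" "x \<subseteq> y" for y
      using x that by (auto simp: total_elems_0)
    ultimately show "\<forall>\<^sub>F y in nhds_total 0 x. ?P (cls 0 y) \<longleftrightarrow> ?P (cls 0 x)"
      by (intro eventually_nhds_total_I[of x]) auto
  qed
  moreover have "\<not> \<sigma> \<subseteq> x" if "x \<in> total_elems 0" "\<tau> \<subseteq> x" for x
    using * that total_elems_pdom[OF that(1)] by (auto simp: consistent_def)
  ultimately show "\<exists>B. openin (Ct 0) B \<and> closedin (Ct 0) B \<and>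
      (\<forall>x\<in>total_elems 0. (\<sigma> \<subseteq> x \<longrightarrow> cls 0 x \<in> B) \<and> (\<tau> \<subseteq> x \<longrightarrow> cls 0 x \<notin> B))"
    using P by (intro exI[of _ "{c \<in> topspace (Ct 0). ?P c}"]) auto
qed

lemma app_total_local:
  assumes x: "x \<in> total_elems (Suc k)" and z: "z \<in> total_elems k"
  shows "\<forall>\<^sub>F y in nhds_total (Suc k) x. app y z = app x z"
proof -
  have "num_eq (app x z) (app x z)" using x z by (simp add: total_elems_def)
  then obtain n where n: "app x z = {Num n}" by (auto simp: num_eq_def)
  then have "Num n \<in> app x z" by simp
  then obtain X where X: "fset X \<subseteq> z" "Arr X n \<in> x" by (auto simp: app_def)
  show ?thesis
  proof (rule eventually_nhds_total_I[of "{Arr X n}"])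
    fix y assume y: "y \<in> total_elems (Suc k)" "{Arr X n} \<subseteq> y"
    then show "app y z = app x z"
      using consistent_token(2)[OF total_elems_pdom[OF y(1)] _ total_elems_pdom[OF z] X(1)] n by simp
  qed (use X in auto)
qed

text \<open>Two conflicting tokens have jointly consistent premises. Density supplies a total
  \<open>z\<close> extending both, and evaluation at \<open>z\<close> is locally constant and tells
  the two sides apart.\<close>

lemma separated_Suc:
  assumes "dense_total k"
  shows "separated (Suc k)"
  unfolding separated_def
proof (intro allI impI)
  fix \<sigma> \<tau>
  assume *: "finite \<sigma> \<and> finite \<tau> \<and> consistent (Suc k) \<sigma> \<and> consistent (Suc k) \<tau> \<and>
    \<not> consistent (Suc k) (\<sigma> \<union> \<tau>)"
  then obtain X n Y m where X: "Arr X n \<in> \<sigma>" and Y: "Arr Y m \<in> \<tau>" and nm: "n \<noteq> m"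
    and "consistent k (fset X \<union> fset Y)"
    using inconsistent_Suc_witness by blast
  then obtain z where z: "z \<in> total_elems k" "fset X \<subseteq> z" "fset Y \<subseteq> z"
    using assms unfolding dense_total_def by (metis finite_UnI finite_fset le_sup_iff)
  let ?T = "total_elems (Suc k)" and ?q = "cls (Suc k)"
  let ?P = "\<lambda>c. \<exists>x\<in>?T. c = ?q x \<and> app x z = {Num n}"
  \<comment> \<open>Evaluation at a total argument respects \<open>total_eq\<close>, so the choice
    of representative inside \<open>?P\<close> is immaterial.\<close>
  have P: "?P (?q x) \<longleftrightarrow> app x z = {Num n}" if x: "x \<in> ?T" for x
  proof -
    have eq: "app x z = app y z" if "?q x = ?q y" for y
    proof -
      have "total_eq (Suc k) x y" using that cls_eq_iff[OF x] by blast
      then have "num_eq (app x z) (app y z)" using z(1) by (simp add: total_elems_def)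
      then show ?thesis by (auto simp: num_eq_def)
    qed
    show ?thesis
    proof
      assume "?P (?q x)"
      then obtain y where "?q x = ?q y" "app y z = {Num n}" by blast
      then show "app x z = {Num n}" using eq by metis
    qed (use x in blast)
  qed
  define B where "B = {c \<in> topspace (Ct (Suc k)). ?P c}"
  have B: "?q x \<in> B \<longleftrightarrow> app x z = {Num n}" if "x \<in> ?T" for x
    using P[OF that] that by (simp add: B_def)
  have "openin (Ct (Suc k)) B \<and> closedin (Ct (Suc k)) B"
    unfolding B_def
  proof (rule clopen_Ct_I)
    fix x assume x: "x \<in> ?T"
    show "\<forall>\<^sub>F y in nhds_total (Suc k) x. ?P (?q y) \<longleftrightarrow> ?P (?q x)"
      using app_total_local[OF x z(1)] eventually_nhds_total_total_elems
    proof eventually_elim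
      case (elim y)
      then show ?case using P[OF x] P[of y] by presburger
    qed
  qed
  moreover have val: "app x z = {Num l}" if "x \<in> ?T" "Arr Z l \<in> x" "fset Z \<subseteq> z" for x Z l
    using consistent_token(2)[OF total_elems_pdom[OF that(1)] that(2) total_elems_pdom[OF z(1)] that(3)] .
  have "?q x \<in> B" if x: "x \<in> ?T" "\<sigma> \<subseteq> x" for x
    using B[OF x(1)] val[OF x(1) subsetD[OF x(2) X] z(2)] by simp
  moreover have "?q x \<notin> B" if x: "x \<in> ?T" "\<tau> \<subseteq> x" for x
    using B[OF x(1)] val[OF x(1) subsetD[OF x(2) Y] z(3)] nm by simp
  ultimately show "\<exists>B. openin (Ct (Suc k)) B \<and> closedin (Ct (Suc k)) B \<and>
      (\<forall>x\<in>?T. (\<sigma> \<subseteq> x \<longrightarrow> ?q x \<in> B) \<and> (\<tau> \<subseteq> x \<longrightarrow> ?q x \<notin> B))"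
    by blast
qed

text \<open>Density at type \<open>k\<close> makes the set of all tokens compatible with a continuous \<open>F\<close>
  single-valued, hence an element of \<open>N(k+1)\<close>.\<close>

lemma total_functional_exists:
  assumes dense: "dense_total k"
    and loc: "\<And>x. x \<in> total_elems k \<Longrightarrow> \<forall>\<^sub>F y in nhds_total k x. F (cls k y) = F (cls k x)"
  obtains G where "G \<in> total_elems (Suc k)"
    "\<And>Y n. consistent k (fset Y) \<Longrightarrow> (\<And>z. z \<in> total_elems k \<Longrightarrow> fset Y \<subseteq> z \<Longrightarrow> F (cls k z) = n) \<Longrightarrow>
       Arr Y n \<in> G"
proof -
  define G where "G = {Arr Y n | Y n. consistent k (fset Y) \<and>
    (\<forall>z\<in>total_elems k. fset Y \<subseteq> z \<longrightarrow> F (cls k z) = n)}"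
  have G_iff: "Arr Y n \<in> G \<longleftrightarrow> consistent k (fset Y) \<and>
      (\<forall>z\<in>total_elems k. fset Y \<subseteq> z \<longrightarrow> F (cls k z) = n)" for Y n
    by (auto simp: G_def)
  have nb: "app G a \<in> nat_bot" if a: "a \<in> pdom k" for a
  proof (rule app_nat_bot_I)
    fix X n Y m assume *: "Arr X n \<in> G" "Arr Y m \<in> G" "fset X \<subseteq> a" "fset Y \<subseteq> a"
    have "consistent k (fset X \<union> fset Y)" using a *(3,4) by (auto simp: consistent_def)
    then obtain z where "z \<in> total_elems k" "fset X \<subseteq> z" "fset Y \<subseteq> z"
      using dense unfolding dense_total_def by (metis finite_UnI finite_fset le_sup_iff)
    then show "n = m" using *(1,2) by (auto simp: G_iff)
  qed
  let ?H = "enc (pdom k) (app G)"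
  have val: "app ?H z = {Num (F (cls k z))}" if z: "z \<in> total_elems k" for z
  proof -
    obtain \<sigma> where \<sigma>: "finite \<sigma>" "\<sigma> \<subseteq> z" "\<forall>y\<in>total_elems k. \<sigma> \<subseteq> y \<longrightarrow> F (cls k y) = F (cls k z)"
      using loc[OF z] unfolding eventually_nhds_total by blast
    have Y: "fset (Abs_fset \<sigma>) = \<sigma>" using \<sigma>(1) by (simp add: Abs_fset_inverse)
    have "Arr (Abs_fset \<sigma>) (F (cls k z)) \<in> G"
      using \<sigma> Y total_elems_pdom[OF z] by (auto simp: G_iff consistent_def)
    then have "Num (F (cls k z)) \<in> app G z" using app_I Y \<sigma>(2) by metis
    then show ?thesis
      using nat_bot_eqI[OF nb[OF total_elems_pdom[OF z]]] enc_app_in_pdom(3)[OF nb] total_elems_pdom[OF z]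
      by simp
  qed
  show thesis
  proof (rule that[of ?H])
    have "num_eq (app ?H a) (app ?H b)" if ab: "total_eq k a b" for a b
    proof -
      have "a \<in> total_elems k" "b \<in> total_elems k"
        using total_eq_trans[OF ab total_eq_sym[OF ab]] total_eq_trans[OF total_eq_sym[OF ab] ab]
        by (auto simp: total_elems_def)
      moreover from this have "cls k a = cls k b" using ab by (simp add: cls_eq_iff)
      ultimately show ?thesis using val by (simp add: num_eq_def)
    qed
    then show "?H \<in> total_elems (Suc k)"
      using enc_app_in_pdom(1)[OF nb] unfolding total_elems_def by (simp del: pdom.simps)
    fix Y n assume "consistent k (fset Y)" "\<And>z. z \<in> total_elems k \<Longrightarrow> fset Y \<subseteq> z \<Longrightarrow> F (cls k z) = n"
    then show "Arr Y n \<in> ?H" using enc_app_in_pdom(2)[OF nb] by (simp add: G_iff)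
  qed
qed

lemma eventually_nhds_total_finite_clopens:
  assumes "finite I" "\<And>i. i \<in> I \<Longrightarrow> openin (Ct k) (B i) \<and> closedin (Ct k) (B i)" "x \<in> total_elems k"
  shows "\<forall>\<^sub>F y in nhds_total k x. \<forall>i\<in>I. cls k y \<in> B i \<longleftrightarrow> cls k x \<in> B i"
  by (rule eventually_ball_finite[OF assms(1)]) (use eventually_nhds_total_clopen assms in blast)

text \<open>Tokens of \<open>\<Sigma>\<close> with different values have inconsistent premises,
  hence are separated by clopen sets. A functional computed from these finitely many sets is
  continuous and can be made to take all prescribed values.\<close>

lemma dense_total_Suc:
  assumes dense: "dense_total k" and sep: "separated k"
  shows "dense_total (Suc k)"
  unfolding dense_total_def
proof (intro allI impI)
  fix \<Sigma> assume *: "finite \<Sigma> \<and> consistent (Suc k) \<Sigma>"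
  then obtain H where H: "H \<in> pdom (Suc k)" "\<Sigma> \<subseteq> H" unfolding consistent_def by blast
  define T where "T = {(Y, n). Arr Y n \<in> \<Sigma>}"
  have "inj_on (\<lambda>(Y, n). Arr Y n) T" by (auto simp: inj_on_def)
  moreover have "(\<lambda>(Y, n). Arr Y n) ` T \<subseteq> \<Sigma>" by (auto simp: T_def)
  ultimately have finT: "finite T" using * finite_subset finite_imageD by metis
  have tok: "consistent k (fset Y)" "\<And>a. a \<in> pdom k \<Longrightarrow> fset Y \<subseteq> a \<Longrightarrow> app H a = {Num n}"
    if "(Y, n) \<in> T" for Y n
    using consistent_token[OF H(1), of Y n] that H(2) by (auto simp: T_def)
  have "\<exists>B. openin (Ct k) B \<and> closedin (Ct k) B \<and>
      (p \<in> T \<and> r \<in> T \<and> snd p \<noteq> snd r \<longrightarrow> (\<forall>x\<in>total_elems k.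
        (fset (fst p) \<subseteq> x \<longrightarrow> cls k x \<in> B) \<and> (fset (fst r) \<subseteq> x \<longrightarrow> cls k x \<notin> B)))" for p r
  proof (cases "p \<in> T \<and> r \<in> T \<and> snd p \<noteq> snd r")
    case True
    obtain Y n Z m where pr: "p = (Y, n)" "r = (Z, m)" by (metis surj_pair)
    then have mem: "(Y, n) \<in> T" "(Z, m) \<in> T" "n \<noteq> m" using True by auto
    have "\<not> consistent k (fset Y \<union> fset Z)"
    proof
      assume "consistent k (fset Y \<union> fset Z)"
      then obtain a where "a \<in> pdom k" "fset Y \<subseteq> a" "fset Z \<subseteq> a" by (auto simp: consistent_def)
      then show False using tok(2)[OF mem(1), of a] tok(2)[OF mem(2), of a] mem(3) by simp
    qed
    then have "\<exists>B. openin (Ct k) B \<and> closedin (Ct k) B \<and> (\<forall>x\<in>total_elems k.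
        (fset Y \<subseteq> x \<longrightarrow> cls k x \<in> B) \<and> (fset Z \<subseteq> x \<longrightarrow> cls k x \<notin> B))"
      using sep tok(1)[OF mem(1)] tok(1)[OF mem(2)] finite_fset unfolding separated_def by metis
    then show ?thesis using mem unfolding pr by simp
  next
    case False
    then show ?thesis by (intro exI[of _ "{}"]) auto
  qed
  then obtain B where B: "\<And>p r. openin (Ct k) (B p r) \<and> closedin (Ct k) (B p r)"
    "\<And>p r x. p \<in> T \<Longrightarrow> r \<in> T \<Longrightarrow> snd p \<noteq> snd r \<Longrightarrow> x \<in> total_elems k \<Longrightarrow>
        (fset (fst p) \<subseteq> x \<longrightarrow> cls k x \<in> B p r) \<and> (fset (fst r) \<subseteq> x \<longrightarrow> cls k x \<notin> B p r)"
    by metis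
  \<comment> \<open>\<open>sel c p\<close> puts \<open>c\<close> on the side of \<open>p\<close>
    against every token with another value. A total extension of the premise of \<open>p\<close>
    selects \<open>p\<close>, and it selects no token with another value.\<close>
  define sel where "sel c p \<longleftrightarrow> p \<in> T \<and> (\<forall>r\<in>T. snd p \<noteq> snd r \<longrightarrow> c \<in> B p r)" for c p
  \<comment> \<open>The second disjunct makes the value 0 where no token is selected.\<close>
  define F where "F c = (LEAST n. (\<exists>Y. sel c (Y, n)) \<or> (\<forall>p. \<not> sel c p))" for c
  have loc: "\<forall>\<^sub>F y in nhds_total k x. F (cls k y) = F (cls k x)" if x: "x \<in> total_elems k" for x
  proof -
    have "\<forall>\<^sub>F y in nhds_total k x. \<forall>i\<in>T \<times> T. cls k y \<in> B (fst i) (snd i) \<longleftrightarrow> cls k x \<in> B (fst i) (snd i)"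
      by (rule eventually_nhds_total_finite_clopens) (use finT B(1) x in auto)
    then show ?thesis
    proof eventually_elim
      case (elim y)
      then have "sel (cls k y) = sel (cls k x)" by (auto simp: sel_def fun_eq_iff)
      then show ?case by (simp add: F_def)
    qed
  qed
  obtain G where G: "G \<in> total_elems (Suc k)"
    "\<And>Y n. consistent k (fset Y) \<Longrightarrow> (\<And>z. z \<in> total_elems k \<Longrightarrow> fset Y \<subseteq> z \<Longrightarrow> F (cls k z) = n) \<Longrightarrow>
       Arr Y n \<in> G"
    using total_functional_exists[of k F, OF dense loc] by blast
  have "\<Sigma> \<subseteq> G"
  proof
    fix t assume t: "t \<in> \<Sigma>"
    then have "t \<in> H" using H(2) by blast
    then obtain Y n where Yn: "t = Arr Y n" by (rule pdom_Suc_only_Arr[OF H(1)])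
    then have T: "(Y, n) \<in> T" using t by (simp add: T_def)
    show "t \<in> G" unfolding Yn
    proof (rule G(2))
      fix z assume z: "z \<in> total_elems k" "fset Y \<subseteq> z"
      have s: "sel (cls k z) (Y, n)" using B(2)[OF T _ _ z(1)] z(2) T by (auto simp: sel_def)
      have "m = n" if "sel (cls k z) (Z, m)" for Z m
      proof (rule ccontr)
        assume "m \<noteq> n"
        then have "cls k z \<in> B (Z, m) (Y, n)" "(Z, m) \<in> T" using that T by (auto simp: sel_def)
        then show False using B(2)[of "(Z, m)" "(Y, n)" z] T z \<open>m \<noteq> n\<close> by simp
      qed
      then show "F (cls k z) = n" unfolding F_def using s by (intro Least_equality) blast+
    qed (use tok(1)[OF T] in simp)
  qed
  then show "\<exists>z\<in>total_elems (Suc k). \<Sigma> \<subseteq> z" using G(1) by blast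
qed

lemma dense_total_separated: "dense_total k \<and> separated k"
  by (induction k) (simp_all add: dense_total_0 separated_0 dense_total_Suc separated_Suc)


section \<open>Selecting sample points\<close>

lemma cont_conv_subseq:
  assumes "cont_conv X Y F f" and r: "strict_mono (r :: nat \<Rightarrow> nat)"
  shows "cont_conv X Y (F \<circ> r) f"
  unfolding cont_conv_def
proof (intro ballI allI impI)
  fix a s assume a: "a \<in> topspace X" and s: "range s \<subseteq> topspace X \<and> limitin X s a sequentially"
  \<comment> \<open>\<open>\<phi>\<close> is a left inverse of \<open>r\<close> that tends to
    infinity. Stretching \<open>s\<close> along it gives a convergent test sequence for
    \<open>F\<close> whose entries at the indices \<open>r j\<close> are \<open>s j\<close>.\<close>
  define \<phi> where "\<phi> m = (LEAST j. m \<le> r j)" for m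
  have \<phi>r: "\<phi> (r j) = j" for j
    unfolding \<phi>_def using r by (intro Least_equality) (auto simp: strict_mono_less_eq)
  have "J < \<phi> m" if "r J < m" for J m
  proof -
    have "m \<le> r (\<phi> m)" unfolding \<phi>_def
      by (rule LeastI[of "\<lambda>j. m \<le> r j" m]) (rule strict_mono_imp_increasing[OF r])
    then have "r J < r (\<phi> m)" using that by simp
    then show ?thesis using r by (simp add: strict_mono_less)
  qed
  then have lim: "filterlim \<phi> sequentially sequentially"
    unfolding filterlim_at_top eventually_sequentially by (metis Suc_le_eq less_imp_le)
  have "limitin X (s \<circ> \<phi>) a sequentially"
    unfolding limitin_def
  proof (intro conjI allI impI)
    fix U assume "openin X U \<and> a \<in> U"
    then have "\<forall>\<^sub>F n in sequentially. s n \<in> U" using s by (auto simp: limitin_def)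
    then show "\<forall>\<^sub>F n in sequentially. (s \<circ> \<phi>) n \<in> U"
      using eventually_compose_filterlim[OF _ lim] by (simp add: comp_def)
  qed (rule a)
  moreover have "range (s \<circ> \<phi>) \<subseteq> topspace X" using s by auto
  ultimately have "limitin Y (\<lambda>n. F n ((s \<circ> \<phi>) n)) (f a) sequentially"
    using assms(1) a unfolding cont_conv_def by blast
  from limitin_subsequence[OF r this] show "limitin Y (\<lambda>n. (F \<circ> r) n (s n)) (f a) sequentially"
    by (simp add: comp_def \<phi>r)
qed

lemma limitin_Ct_I:
  assumes "x \<in> total_elems k" "\<And>m. y m \<in> total_elems k" "\<And>t. t \<in> x \<Longrightarrow> \<forall>\<^sub>F m in sequentially. t \<in> y m"
  shows "limitin (Ct k) (\<lambda>m. cls k (y m)) (cls k x) sequentially"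
  unfolding limitin_def
proof (intro conjI allI impI)
  fix U assume "openin (Ct k) U \<and> cls k x \<in> U"
  then obtain \<sigma> where \<sigma>: "finite \<sigma>" "\<sigma> \<subseteq> x" "\<forall>z\<in>total_elems k. \<sigma> \<subseteq> z \<longrightarrow> cls k z \<in> U"
    using assms(1) unfolding openin_Ct_iff eventually_nhds_total by blast
  have "\<forall>\<^sub>F m in sequentially. \<forall>t\<in>\<sigma>. t \<in> y m"
    by (rule eventually_ball_finite[OF \<sigma>(1)]) (use assms(3) \<sigma>(2) in blast)
  then show "\<forall>\<^sub>F m in sequentially. cls k (y m) \<in> U"
    by (rule eventually_mono) (use \<sigma>(3) assms(2) in blast)
qed (use assms in simp)

text \<open>Upgrades sequential convergence to a neighbourhood statement uniform in late
  \<open>m\<close>. Finite parts give a countable base at \<open>x\<close>, so a failure would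
  produce a convergent sequence, and a subsequence of \<open>F\<close>, along which convergence
  breaks.\<close>

lemma cont_conv_eventually_near:
  assumes conv: "cont_conv (subtopology (Ct k) A) euclideanreal F f"
    and x: "x \<in> total_elems k" "cls k x \<in> A" and e: "(e::real) > 0"
  shows "\<exists>M. \<forall>\<^sub>F y in nhds_total k x. \<forall>m\<ge>M. cls k y \<in> A \<longrightarrow> \<bar>F m (cls k y) - f (cls k x)\<bar> < e"
proof (rule ccontr)
  assume no: "\<not> ?thesis"
  \<comment> \<open>Tokens are countable, so these are finite parts increasing to
    \<open>x\<close>.\<close>
  define \<sigma> where "\<sigma> j = {t \<in> x. to_nat t \<le> j}" for j
  define bad where "bad j m y \<longleftrightarrow> y \<in> total_elems k \<and> \<sigma> j \<subseteq> y \<and> cls k y \<in> A \<and>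
    \<not> \<bar>F m (cls k y) - f (cls k x)\<bar> < e" for j m y
  have fin: "finite (\<sigma> j)" for j
  proof (rule finite_imageD)
    show "finite (to_nat ` \<sigma> j)" by (rule finite_subset[of _ "{..j}"]) (auto simp: \<sigma>_def)
  qed (simp add: inj_on_def)
  have ex: "\<exists>m\<ge>i. \<exists>y. bad j m y" for i j
  proof (rule ccontr)
    assume "\<not> ?thesis"
    then have "\<forall>\<^sub>F y in nhds_total k x. \<forall>m\<ge>i. cls k y \<in> A \<longrightarrow> \<bar>F m (cls k y) - f (cls k x)\<bar> < e"
      by (intro eventually_nhds_total_I[OF fin[of j]]) (auto simp: \<sigma>_def bad_def)
    then show False using no by blast
  qed
  have "\<exists>r. \<forall>j. (\<exists>y. bad j (r j) y) \<and> r j < r (Suc j)"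
  proof (rule dependent_nat_choice)
    show "\<exists>m. \<exists>y. bad 0 m y" using ex[of 0 0] by blast
    show "\<exists>m'. (\<exists>y. bad (Suc j) m' y) \<and> m < m'" for m j
      using ex[of "Suc m" "Suc j"] by (auto simp: Suc_le_eq)
  qed
  then obtain r where r: "\<And>j. \<exists>y. bad j (r j) y" "\<And>j. r j < r (Suc j)" by blast
  then obtain y where y: "\<And>j. bad j (r j) (y j)" by metis
  have "strict_mono r" using r(2) by (simp add: strict_mono_Suc_iff)
  have "limitin (Ct k) (\<lambda>j. cls k (y j)) (cls k x) sequentially"
  proof (rule limitin_Ct_I)
    fix t assume "t \<in> x"
    then have "t \<in> y j" if "j \<ge> to_nat t" for j using y[of j] that by (auto simp: bad_def \<sigma>_def)
    then show "\<forall>\<^sub>F j in sequentially. t \<in> y j" unfolding eventually_sequentially by blast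
  qed (use x y in \<open>auto simp: bad_def\<close>)
  then have "limitin (subtopology (Ct k) A) (\<lambda>j. cls k (y j)) (cls k x) sequentially"
    using x y by (simp add: limitin_subtopology bad_def)
  moreover have "range (\<lambda>j. cls k (y j)) \<subseteq> topspace (subtopology (Ct k) A)"
    using y by (auto simp: bad_def)
  moreover have "cls k x \<in> topspace (subtopology (Ct k) A)" using x by simp
  ultimately have "limitin euclideanreal (\<lambda>j. (F \<circ> r) j (cls k (y j))) (f (cls k x)) sequentially"
    using cont_conv_subseq[OF conv \<open>strict_mono r\<close>] unfolding cont_conv_def by blast
  then have "(\<lambda>j. F (r j) (cls k (y j))) \<longlonglongrightarrow> f (cls k x)" by simp
  then have "\<forall>\<^sub>F j in sequentially. \<bar>F (r j) (cls k (y j)) - f (cls k x)\<bar> < e"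
    using e by (auto simp: tendsto_iff dist_real_def)
  then obtain j where "\<bar>F (r j) (cls k (y j)) - f (cls k x)\<bar> < e"
    unfolding eventually_sequentially by blast
  then show False using y[of j] by (simp add: bad_def)
qed

text \<open>The \<open>s i\<close> enumerate all finite pieces of information about elements of \<open>A\<close>, and \<open>z i\<close> is
  a representative of an element of \<open>A\<close> extending \<open>s i\<close>.\<close>

locale extension_data =
  fixes k :: nat and A :: "tok set set set" and s :: "nat \<Rightarrow> tok set" and z :: "nat \<Rightarrow> tok set"
    and B :: "nat \<Rightarrow> nat \<Rightarrow> tok set set set" and C :: "nat \<Rightarrow> tok set set set"
  assumes C_clopen: "openin (Ct k) (C n) \<and> closedin (Ct k) (C n)" and A_eq: "A = (\<Inter>n. C n)"
    and s_z: "s i \<subseteq> z i" and z_total: "z i \<in> total_elems k" and z_A: "cls k (z i) \<in> A"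
    and s_surj: "finite \<sigma> \<Longrightarrow> x \<in> total_elems k \<Longrightarrow> cls k x \<in> A \<Longrightarrow> \<sigma> \<subseteq> x \<Longrightarrow> \<exists>i. s i = \<sigma>"
    and s_finite: "finite (s i)"
    and B_clopen: "openin (Ct k) (B i l) \<and> closedin (Ct k) (B i l)"
    and B_in: "x \<in> total_elems k \<Longrightarrow> s i \<subseteq> x \<Longrightarrow> cls k x \<in> B i l"
    and B_out: "\<not> consistent k (s i \<union> s l) \<Longrightarrow> x \<in> total_elems k \<Longrightarrow> s l \<subseteq> x \<Longrightarrow> cls k x \<notin> B i l"
begin

definition sample :: "nat \<Rightarrow> tok set set" where "sample i = cls k (z i)"

text \<open>Here \<open>E\<close> records which of the sampled values of a function on \<open>A\<close> count as close. An index
  survives if, as far as can be seen from the first \<open>n\<close> samples, the function is almost constant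
  on the elements extending \<open>s i\<close>. Only finitely many of the conditions separating \<open>s i\<close> from
  inconsistent information are tested, which keeps \<open>select n E\<close> locally constant.\<close>

definition survives :: "nat \<Rightarrow> (nat \<times> nat) set \<Rightarrow> nat \<Rightarrow> bool" where
  "survives n E i \<longleftrightarrow> (\<forall>l\<le>n. s i \<subseteq> s l \<longrightarrow> (i, l) \<in> E)"

text \<open>The disjunct \<open>i = n\<close> guarantees that a least index exists and is at most
  \<open>n\<close>.\<close>

definition select :: "nat \<Rightarrow> (nat \<times> nat) set \<Rightarrow> tok set set \<Rightarrow> nat" where
  "select n E c = (LEAST i. i = n \<or> i < n \<and> survives n E i \<and> (\<forall>l\<le>n. c \<in> B i l))"

lemma select_le: "select n E c \<le> n"
  unfolding select_def by (rule Least_le) simp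

lemma select_less: "select n E c < n \<Longrightarrow> survives n E (select n E c) \<and> (\<forall>l\<le>n. c \<in> B (select n E c) l)"
  using LeastI[of "\<lambda>i. i = n \<or> i < n \<and> survives n E i \<and> (\<forall>l\<le>n. c \<in> B i l)" n, folded select_def] by auto

lemma select_le_I: "i < n \<Longrightarrow> survives n E i \<Longrightarrow> (\<And>l. l \<le> n \<Longrightarrow> c \<in> B i l) \<Longrightarrow> select n E c \<le> i"
  unfolding select_def by (rule Least_le) simp

lemma select_cong:
  assumes "\<And>i l. i \<le> n \<Longrightarrow> l \<le> n \<Longrightarrow> (i, l) \<in> E \<longleftrightarrow> (i, l) \<in> E'"
  shows "select n E c = select n E' c"
proof -
  have "survives n E i = survives n E' i" if "i < n" for i
    using assms that by (auto simp: survives_def)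
  then show ?thesis unfolding select_def by (metis (no_types, lifting))
qed

lemma select_local:
  assumes "x \<in> total_elems k"
  shows "\<forall>\<^sub>F y in nhds_total k x. \<forall>E. select n E (cls k y) = select n E (cls k x)"
proof -
  have "\<forall>\<^sub>F y in nhds_total k x. \<forall>p\<in>{..n} \<times> {..n}. cls k y \<in> B (fst p) (snd p) \<longleftrightarrow> cls k x \<in> B (fst p) (snd p)"
    by (rule eventually_nhds_total_finite_clopens) (use assms B_clopen in auto)
  then show ?thesis
  proof (rule eventually_mono, intro allI)
    fix y E
    assume "\<forall>p\<in>{..n} \<times> {..n}. cls k y \<in> B (fst p) (snd p) \<longleftrightarrow> cls k x \<in> B (fst p) (snd p)"
    then have "(i = n \<or> i < n \<and> survives n E i \<and> (\<forall>l\<le>n. cls k y \<in> B i l)) =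
        (i = n \<or> i < n \<and> survives n E i \<and> (\<forall>l\<le>n. cls k x \<in> B i l))" for i
      by auto
    then show "select n E (cls k y) = select n E (cls k x)" unfolding select_def by simp
  qed
qed

text \<open>Between \<open>e\<close> and \<open>2 * e\<close> membership is free. This slack lets
  weights that vary continuously with \<open>v\<close> pass from one pattern to another.\<close>

definition pattern :: "real \<Rightarrow> nat \<Rightarrow> (nat \<Rightarrow> real) \<Rightarrow> (nat \<times> nat) set \<Rightarrow> bool" where
  "pattern e n v E \<longleftrightarrow> (\<forall>i\<le>n. \<forall>l\<le>n. (\<bar>v i - v l\<bar> < e \<longrightarrow> (i, l) \<in> E) \<and>
     ((i, l) \<in> E \<longrightarrow> \<bar>v i - v l\<bar> < 2 * e))"

lemma inconsistent_finite_part: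
  assumes "x \<in> total_elems k" "cls k x \<in> A" "\<not> consistent k (s j \<union> x)"
  obtains l where "s l \<subseteq> x" "\<not> consistent k (s j \<union> s l)"
proof -
  obtain \<sigma> where \<sigma>: "finite \<sigma>" "\<sigma> \<subseteq> x" "\<not> consistent k (s j \<union> \<sigma>)"
    using consistent_compactness[OF s_finite, of x k j] assms(3) by blast
  then obtain l where "s l = \<sigma>" using s_surj[OF _ assms(1,2)] by blast
  then show thesis using that[of l] \<sigma> by simp
qed

context
  fixes F :: "nat \<Rightarrow> tok set set \<Rightarrow> real" and f :: "tok set set \<Rightarrow> real" and e :: real
    and x :: "tok set"
  assumes conv: "cont_conv (subtopology (Ct k) A) euclideanreal F f"
    and x: "x \<in> total_elems k" "cls k x \<in> A" and e: "e > 0"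
begin

text \<open>All finite parts of representatives of points of \<open>A\<close> occur among the
  \<open>s i\<close>, so a whole neighbourhood on which \<open>F m\<close> is close to the limit can
  be named by one index. Another representative \<open>x'\<close> is allowed because
  \<open>survivor_near\<close> moves to a join.\<close>

lemma near_index:
  assumes "x' \<in> total_elems k" "cls k x' = cls k x" "\<tau> \<subseteq> x'" "finite \<tau>"
  obtains i M where "\<tau> \<subseteq> s i" "s i \<subseteq> x'"
    "\<And>l m. m \<ge> M \<Longrightarrow> s i \<subseteq> s l \<Longrightarrow> \<bar>F m (sample l) - f (cls k x)\<bar> < e / 2"
proof -
  have x': "cls k x' \<in> A" "e / 2 > 0" using assms(2) x e by simp_all
  obtain M \<sigma> where \<sigma>: "finite \<sigma>" "\<sigma> \<subseteq> x'"
    "\<forall>y\<in>total_elems k. \<sigma> \<subseteq> y \<longrightarrow> (\<forall>m\<ge>M. cls k y \<in> A \<longrightarrow> \<bar>F m (cls k y) - f (cls k x')\<bar> < e / 2)"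
    using cont_conv_eventually_near[OF conv assms(1) x'] unfolding eventually_nhds_total by blast
  have "finite (\<sigma> \<union> \<tau>)" "\<sigma> \<union> \<tau> \<subseteq> x'" using \<sigma> assms by auto
  then obtain i where i: "s i = \<sigma> \<union> \<tau>" using s_surj[OF _ assms(1) x'(1)] by blast
  show thesis
  proof (rule that[of i M])
    fix l m assume "m \<ge> M" "s i \<subseteq> s l"
    then show "\<bar>F m (sample l) - f (cls k x)\<bar> < e / 2"
      using \<sigma>(3) z_total[of l] z_A[of l] s_z[of l] i assms(2) unfolding sample_def by auto
  qed (use i \<sigma>(2) assms(3) in auto)
qed

text \<open>In the consistent case \<open>2 * e\<close> comes from comparing \<open>j\<close> with a
  refining index \<open>i\<close> through the pattern, and \<open>e / 2\<close> from
  \<open>near_index\<close>. In the inconsistent case one clopen condition rejects \<open>j\<close>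
  near \<open>x\<close>, once \<open>n\<close> is large enough to test it.\<close>

lemma survivor_near:
  "\<exists>L. \<forall>\<^sub>F y in nhds_total k x. \<forall>m\<ge>L. \<forall>n\<ge>L. \<forall>E. j \<le> n \<longrightarrow> pattern e n (\<lambda>i. F m (sample i)) E \<longrightarrow> survives n E j \<longrightarrow>
      (\<forall>l\<le>n. cls k y \<in> B j l) \<longrightarrow> \<bar>F m (sample j) - f (cls k x)\<bar> < 3 * e"
proof (cases "consistent k (s j \<union> x)")
  case True
  then obtain x' where x': "x' \<in> pdom k" "s j \<subseteq> x'" "x \<subseteq> x'" unfolding consistent_def by blast
  have eq: "total_eq k x x'" using total_eq_superset[OF x(1) x'(3,1)] .
  then have "x' \<in> total_elems k" using total_eq_trans[OF total_eq_sym[OF eq] eq] by (simp add: total_elems_def)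
  moreover have "cls k x' = cls k x" using eq cls_eq_iff[OF x(1), of x'] by simp
  ultimately obtain i M where i: "s j \<subseteq> s i" "s i \<subseteq> x'"
    "\<And>l m. m \<ge> M \<Longrightarrow> s i \<subseteq> s l \<Longrightarrow> \<bar>F m (sample l) - f (cls k x)\<bar> < e / 2"
    using near_index[of x' "s j"] x'(2) s_finite by blast
  have "\<bar>F m (sample j) - f (cls k x)\<bar> < 3 * e"
    if "m \<ge> max M i" "n \<ge> max M i" "j \<le> n" "pattern e n (\<lambda>i. F m (sample i)) E" "survives n E j" for m n E
  proof -
    have "(j, i) \<in> E" "i \<le> n" using that i(1) by (auto simp: survives_def)
    then have "\<bar>F m (sample j) - F m (sample i)\<bar> < 2 * e" using that(3,4) by (simp add: pattern_def)
    moreover have "\<bar>F m (sample i) - f (cls k x)\<bar> < e / 2" using i(3)[of m i] that(1) by simp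
    ultimately show ?thesis by linarith
  qed
  then show ?thesis by (intro exI[of _ "max M i"] always_eventually) blast
next
  case False
  then obtain l where l: "s l \<subseteq> x" "\<not> consistent k (s j \<union> s l)"
    using inconsistent_finite_part[OF x] by blast
  have "\<forall>\<^sub>F y in nhds_total k x. cls k y \<notin> B j l"
    by (rule eventually_nhds_total_I[OF s_finite l(1)]) (rule B_out[OF l(2)])
  then have "\<forall>\<^sub>F y in nhds_total k x. \<forall>m\<ge>l. \<forall>n\<ge>l. \<forall>E. j \<le> n \<longrightarrow> pattern e n (\<lambda>i. F m (sample i)) E \<longrightarrow> survives n E j \<longrightarrow>
      (\<forall>l\<le>n. cls k y \<in> B j l) \<longrightarrow> \<bar>F m (sample j) - f (cls k x)\<bar> < 3 * e"
    by (rule eventually_mono) blast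
  then show ?thesis by (intro exI[of _ l])
qed

text \<open>A good index \<open>i\<close> below \<open>x\<close> survives and is accepted near
  \<open>x\<close>, so the choice never exceeds \<open>i\<close>. Only finitely many competitors
  \<open>j\<close> remain, and their bounds from \<open>survivor_near\<close> combine into
  one.\<close>

lemma selected_near:
  "\<exists>N. \<forall>\<^sub>F y in nhds_total k x. \<forall>m\<ge>N. \<forall>n\<ge>N. \<forall>E. pattern e n (\<lambda>i. F m (sample i)) E \<longrightarrow>
      \<bar>F m (sample (select n E (cls k y))) - f (cls k x)\<bar> < 3 * e"
proof -
  obtain i M where i: "s i \<subseteq> x" "\<And>l m. m \<ge> M \<Longrightarrow> s i \<subseteq> s l \<Longrightarrow> \<bar>F m (sample l) - f (cls k x)\<bar> < e / 2"
    using near_index[OF x(1) refl, of "{}"] by auto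
  define Q where "Q j y m n E \<longleftrightarrow> (j \<le> n \<longrightarrow> pattern e n (\<lambda>i. F m (sample i)) E \<longrightarrow> survives n E j \<longrightarrow>
      (\<forall>l\<le>n. cls k y \<in> B j l) \<longrightarrow> \<bar>F m (sample j) - f (cls k x)\<bar> < 3 * e)" for j y m n E
  define R where "R j L \<longleftrightarrow> (\<forall>\<^sub>F y in nhds_total k x. \<forall>m\<ge>L. \<forall>n\<ge>L. \<forall>E. Q j y m n E)" for j L
  have "\<exists>L. R j L" for j unfolding R_def Q_def by (rule survivor_near)
  then obtain L where "\<And>j. R j (L j)" by metis
  then have L: "\<And>j. \<forall>\<^sub>F y in nhds_total k x. \<forall>m\<ge>L j. \<forall>n\<ge>L j. \<forall>E. Q j y m n E" unfolding R_def .
  \<comment> \<open>\<open>Suc i\<close> forces \<open>i < n\<close>, and the sum dominates every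
    \<open>L j\<close> with \<open>j \<le> i\<close>.\<close>
  define N where "N = M + Suc i + sum L {..i}"
  have "L j \<le> sum L {..i}" if "j \<le> i" for j using that by (intro member_le_sum) auto
  then have N: "M \<le> N" "i < N" "\<And>j. j \<le> i \<Longrightarrow> L j \<le> N"
    unfolding N_def by (auto intro: trans_le_add2 le_SucI)
  have "\<forall>\<^sub>F y in nhds_total k x. \<forall>j\<in>{..i}. \<forall>m\<ge>L j. \<forall>n\<ge>L j. \<forall>E. Q j y m n E"
    by (rule eventually_ball_finite) (use L in auto)
  moreover have "\<forall>\<^sub>F y in nhds_total k x. y \<in> total_elems k \<and> s i \<subseteq> y"
    by (rule eventually_nhds_total_I[OF s_finite i(1)]) simp
  ultimately have "\<forall>\<^sub>F y in nhds_total k x. \<forall>m\<ge>N. \<forall>n\<ge>N. \<forall>E. pattern e n (\<lambda>i. F m (sample i)) E \<longrightarrow>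
      \<bar>F m (sample (select n E (cls k y))) - f (cls k x)\<bar> < 3 * e"
  proof eventually_elim
    case (elim y)
    show ?case
    proof (intro allI impI)
      fix m n E assume mn: "m \<ge> N" "n \<ge> N" and E: "pattern e n (\<lambda>i. F m (sample i)) E"
      have "survives n E i" unfolding survives_def
      proof (intro allI impI)
        fix l assume l: "l \<le> n" "s i \<subseteq> s l"
        have "\<bar>F m (sample i) - f (cls k x)\<bar> < e / 2" "\<bar>F m (sample l) - f (cls k x)\<bar> < e / 2"
          using i(2)[of m i] i(2)[of m l] l mn N(1) by auto
        then have "\<bar>F m (sample i) - F m (sample l)\<bar> < e" by linarith
        then show "(i, l) \<in> E" using E l N(2) mn by (simp add: pattern_def)
      qed
      then have le: "select n E (cls k y) \<le> i"
        using select_le_I[of i n E] B_in elim(2) N(2) mn by auto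
      then have "select n E (cls k y) < n" using N(2) mn by simp
      then have "survives n E (select n E (cls k y))" "\<forall>l\<le>n. cls k y \<in> B (select n E (cls k y)) l"
        using select_less by blast+
      moreover have "Q (select n E (cls k y)) y m n E"
        using elim(1) le N(3)[OF le] mn by (meson atMost_iff order_trans)
      ultimately show "\<bar>F m (sample (select n E (cls k y))) - f (cls k x)\<bar> < 3 * e"
        using E select_le by (simp add: Q_def)
    qed
  qed
  then show ?thesis by (intro exI[of _ N])
qed

end

end


section \<open>The extension operators\<close>

text \<open>For positive \<open>e\<close>, the piecewise linear cutoff equal to 1 up to
  \<open>e\<close> and to 0 from \<open>2 * e\<close> on.\<close>

definition bump :: "real \<Rightarrow> real \<Rightarrow> real" where
  "bump e t = max 0 (min 1 (2 - t / e))"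

definition clip :: "real \<Rightarrow> real \<Rightarrow> real" where
  "clip d t = max (- d) (min d t)"

lemma abs_clip_le: "0 \<le> d \<Longrightarrow> \<bar>clip d t\<bar> \<le> d"
  unfolding clip_def by linarith

lemma clip_eq: "\<bar>t\<bar> \<le> d \<Longrightarrow> clip d t = t"
  unfolding clip_def by linarith

text \<open>Below \<open>P\<close> consecutive differences are at most \<open>5 / 2 ^ p\<close>, so
  clipping leaves them alone and the sum telescopes. Later terms form a geometric series of total at
  most \<open>10 / 2 ^ P\<close>; the summand \<open>- 10 / 2 ^ n\<close> keeps its unspent tail
  through the induction.\<close>

lemma abs_telescope_clip_le:
  fixes d :: "nat \<Rightarrow> real"
  assumes d: "\<And>p. p \<le> P \<Longrightarrow> \<bar>d p - r\<bar> \<le> 3 / 2 ^ p" and "P \<le> n"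
  shows "\<bar>d 0 + (\<Sum>p<n. clip (5 / 2 ^ p) (d (Suc p) - d p)) - r\<bar> \<le> 13 / 2 ^ P - 10 / 2 ^ n"
  using \<open>P \<le> n\<close>
proof (induction n rule: dec_induct)
  case base
  have "clip (5 / 2 ^ p) (d (Suc p) - d p) = d (Suc p) - d p" if "p < P" for p
  proof -
    have "\<bar>d (Suc p) - d p\<bar> \<le> 3 / 2 ^ Suc p + 3 / 2 ^ p"
      using d[of p] d[of "Suc p"] that by linarith
    also have "\<dots> \<le> 5 / 2 ^ p" by (simp add: field_simps)
    finally show ?thesis by (rule clip_eq)
  qed
  then have "(\<Sum>p<P. clip (5 / 2 ^ p) (d (Suc p) - d p)) = d P - d 0"
    by (simp add: sum_lessThan_telescope)
  then show ?case using d[of P] by (simp add: field_simps)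
next
  case (step n)
  have "\<bar>clip (5 / 2 ^ n) (d (Suc n) - d n)\<bar> \<le> 5 / 2 ^ n" by (rule abs_clip_le) simp
  moreover have "10 / 2 ^ n - 5 / 2 ^ n = (10 / 2 ^ Suc n :: real)" by (simp add: field_simps)
  ultimately show ?case using step.IH unfolding sum.lessThan_Suc by linarith
qed

section \<open>Criteria for continuity and continuous convergence\<close>

lemma continuous_map_Ct_I:
  assumes "\<And>x e. x \<in> total_elems k \<Longrightarrow> e > 0 \<Longrightarrow> \<forall>\<^sub>F y in nhds_total k x. \<bar>g (cls k y) - g (cls k x)\<bar> < (e::real)"
  shows "continuous_map (Ct k) euclideanreal g"
  unfolding continuous_map_def
proof (intro conjI allI impI)
  fix U assume "openin euclideanreal U"
  then have U: "open U" by simp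
  show "openin (Ct k) {c \<in> topspace (Ct k). g c \<in> U}"
    unfolding openin_Ct_iff
  proof (intro conjI ballI impI)
    fix x assume x: "x \<in> total_elems k" "cls k x \<in> {c \<in> topspace (Ct k). g c \<in> U}"
    then obtain e where e: "e > 0" "\<And>t. \<bar>t - g (cls k x)\<bar> < e \<Longrightarrow> t \<in> U"
      using U unfolding open_dist by (auto simp: dist_real_def)
    show "\<forall>\<^sub>F y in nhds_total k x. cls k y \<in> {c \<in> topspace (Ct k). g c \<in> U}"
      using assms[OF x(1) e(1)] eventually_nhds_total_total_elems by eventually_elim (use e(2) in simp)
  qed auto
qed simp

text \<open>Convergent sequences in the quotient are not lifted to representatives. Instead the
  sequence \<open>g\<close> is equicontinuous, which yields a genuine open set of
  \<open>Ct k\<close> around the limit point.\<close>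

lemma cont_conv_Ct_I:
  assumes near: "\<And>x e. x \<in> total_elems k \<Longrightarrow> e > 0 \<Longrightarrow>
      \<exists>N. \<forall>\<^sub>F y in nhds_total k x. \<forall>m\<ge>N. \<bar>g m (cls k y) - h (cls k x)\<bar> < (e::real)"
    and cont: "\<And>m x e. x \<in> total_elems k \<Longrightarrow> e > 0 \<Longrightarrow>
      \<forall>\<^sub>F y in nhds_total k x. \<bar>g m (cls k y) - g m (cls k x)\<bar> < e"
  shows "cont_conv (Ct k) euclideanreal g h"
proof -
  \<comment> \<open>Late indices are covered by \<open>near\<close> at tolerance
    \<open>e / 2\<close>, the finitely many early ones by \<open>cont\<close>.\<close>
  have equi: "\<forall>\<^sub>F y in nhds_total k x. \<forall>m. \<bar>g m (cls k y) - g m (cls k x)\<bar> < e"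
    if x: "x \<in> total_elems k" and e: "e > 0" for x e
  proof -
    obtain N where N: "\<forall>\<^sub>F y in nhds_total k x. \<forall>m\<ge>N. \<bar>g m (cls k y) - h (cls k x)\<bar> < e / 2"
      using near[OF x, of "e / 2"] e by auto
    have "\<forall>\<^sub>F y in nhds_total k x. \<forall>m\<in>{..<N}. \<bar>g m (cls k y) - g m (cls k x)\<bar> < e"
      by (rule eventually_ball_finite) (use cont[OF x e] in auto)
    then show ?thesis using N
    proof eventually_elim
      case (elim y)
      have "\<bar>g m (cls k y) - g m (cls k x)\<bar> < e" if "m \<ge> N" for m
        using elim(2) eventually_nhds_total_self[OF N x] that by (smt (verit) field_sum_of_halves)
      then show ?case using elim(1) by (metis lessThan_iff not_le)
    qed
  qed
  show ?thesis
    unfolding cont_conv_def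
  proof (intro ballI allI impI)
    fix c t assume c: "c \<in> topspace (Ct k)" and t: "range t \<subseteq> topspace (Ct k) \<and> limitin (Ct k) t c sequentially"
    obtain x where x: "x \<in> total_elems k" "c = cls k x" using c by (auto simp: topspace_Ct_cls)
    have lim0: "(\<lambda>m. g m c) \<longlonglongrightarrow> h c"
      unfolding tendsto_iff dist_real_def
    proof (intro allI impI)
      fix e :: real assume "e > 0"
      then obtain N where "\<forall>\<^sub>F y in nhds_total k x. \<forall>m\<ge>N. \<bar>g m (cls k y) - h (cls k x)\<bar> < e"
        using near[OF x(1)] by blast
      from eventually_nhds_total_self[OF this x(1)] show "\<forall>\<^sub>F m in sequentially. \<bar>g m c - h c\<bar> < e"
        unfolding eventually_sequentially x(2) by blast
    qed
    have "(\<lambda>m. g m (t m) - g m c) \<longlonglongrightarrow> 0"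
      unfolding tendsto_iff dist_real_def
    proof (intro allI impI)
      fix e :: real assume e: "e > 0"
      \<comment> \<open>A uniform bound \<open>r\<close> strictly below \<open>e\<close> leaves
        slack around every point of \<open>V\<close>, which makes \<open>V\<close> open.\<close>
      define V where "V = {b \<in> topspace (Ct k). \<exists>r<e. \<forall>m. \<bar>g m b - g m c\<bar> \<le> r}"
      have "openin (Ct k) V"
        unfolding openin_Ct_iff
      proof (intro conjI ballI impI)
        fix y assume y: "y \<in> total_elems k" "cls k y \<in> V"
        then obtain r where r: "r < e" "\<And>m. \<bar>g m (cls k y) - g m c\<bar> \<le> r" by (auto simp: V_def)
        have "(e - r) / 2 > 0" using r by simp
        from equi[OF y(1) this] eventually_nhds_total_total_elems show "\<forall>\<^sub>F w in nhds_total k y. cls k w \<in> V"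
        proof eventually_elim
          case (elim w)
          have "\<bar>g m (cls k w) - g m c\<bar> \<le> (e + r) / 2" for m
          proof -
            have "\<bar>g m (cls k w) - g m c\<bar> \<le> \<bar>g m (cls k w) - g m (cls k y)\<bar> + \<bar>g m (cls k y) - g m c\<bar>"
              by linarith
            also have "\<dots> \<le> (e - r) / 2 + r"
              using elim(1)[rule_format, of m] r(2)[of m] by (intro add_mono) auto
            finally show ?thesis by (simp add: field_simps)
          qed
          moreover have "(e + r) / 2 < e" using r by simp
          ultimately have "\<exists>r<e. \<forall>m. \<bar>g m (cls k w) - g m c\<bar> \<le> r" by blast
          then show ?case using elim(2) by (simp add: V_def)
        qed
      qed (auto simp: V_def)
      moreover have "c \<in> V" using c e by (auto simp: V_def intro!: exI[of _ 0])
      ultimately have "\<forall>\<^sub>F m in sequentially. t m \<in> V" using t by (auto simp: limitin_def)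
      then show "\<forall>\<^sub>F m in sequentially. \<bar>g m (t m) - g m c - 0\<bar> < e"
        by (rule eventually_mono) (fastforce simp: V_def intro: le_less_trans)
    qed
    from tendsto_add[OF this lim0] show "limitin euclideanreal (\<lambda>n. g n (t n)) (h c) sequentially"
      by simp
  qed
qed

lemma openin_cfun_topology: "openin (cfun_topology X Y) U \<longleftrightarrow> cc_seq_open X Y U"
proof -
  have "cfun_topology X Y = topology (cc_seq_open X Y)"
    by (rule finest_conv_topology_unique[OF finest_conv_topology_cfun_topology finest_conv_topology_cc_seq_open])
  then show ?thesis by (simp add: istopology_cc_seq_open)
qed

text \<open>The open sets on both sides are the sequentially open ones for continuous convergence,
  so it suffices to preserve convergent sequences.\<close>

lemma continuous_map_cfun_topology_I:
  assumes cf: "\<And>f. f \<in> cfun X Y \<Longrightarrow> \<Phi> f \<in> cfun X' Y'"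
    and conv: "\<And>F f. range F \<subseteq> cfun X Y \<Longrightarrow> f \<in> cfun X Y \<Longrightarrow> cont_conv X Y F f \<Longrightarrow>
      cont_conv X' Y' (\<lambda>m. \<Phi> (F m)) (\<Phi> f)"
  shows "continuous_map (cfun_topology X Y) (cfun_topology X' Y') \<Phi>"
  unfolding continuous_map_def
proof (intro conjI allI impI)
  fix U assume "openin (cfun_topology X' Y') U"
  then have U: "cc_seq_open X' Y' U" by (simp add: openin_cfun_topology)
  show "openin (cfun_topology X Y) {f \<in> topspace (cfun_topology X Y). \<Phi> f \<in> U}"
    unfolding openin_cfun_topology cc_seq_open_def
  proof (intro conjI allI impI)
    fix F f assume *: "range F \<subseteq> cfun X Y \<and> f \<in> {f \<in> topspace (cfun_topology X Y). \<Phi> f \<in> U} \<and> cont_conv X Y F f"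
    then have "cont_conv X' Y' (\<lambda>m. \<Phi> (F m)) (\<Phi> f)" using conv by simp
    moreover have "range (\<lambda>m. \<Phi> (F m)) \<subseteq> cfun X' Y'" using * cf by auto
    ultimately have "\<forall>\<^sub>F m in sequentially. \<Phi> (F m) \<in> U" using cc_seq_openD[OF U] * by blast
    then show "\<forall>\<^sub>F m in sequentially. F m \<in> {f \<in> topspace (cfun_topology X Y). \<Phi> f \<in> U}"
      by (rule eventually_mono) (use * in auto)
  qed auto
qed (use cf in auto)

lemma cont_conv_cong:
  assumes "\<And>m c. c \<in> topspace X \<Longrightarrow> F m c = G m c" "\<And>c. c \<in> topspace X \<Longrightarrow> f c = g c"
  shows "cont_conv X Y F f \<longleftrightarrow> cont_conv X Y G g"
proof -
  have "(\<lambda>n. F n (t n)) = (\<lambda>n. G n (t n))" if "range t \<subseteq> topspace X" for t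
    using that assms(1) by (auto simp: fun_eq_iff)
  then show ?thesis unfolding cont_conv_def using assms(2) by (metis (no_types, lifting))
qed

lemma cont_conv_const:
  assumes "continuous_map X Y f"
  shows "cont_conv X Y (\<lambda>_. f) f"
  unfolding cont_conv_def using continuous_map_limit[OF assms] by (auto simp: comp_def)

text \<open>Naturals are uniformly isolated in the reals. This lets the convergence arguments for
  natural-number values be carried out for reals.\<close>

lemma limitin_discrete_nat_iff:
  "limitin (discrete_topology UNIV) u l sequentially \<longleftrightarrow> (\<lambda>n. real (u n)) \<longlonglongrightarrow> real l"
proof
  assume "limitin (discrete_topology UNIV) u l sequentially"
  then have "\<forall>\<^sub>F n in sequentially. u n \<in> {l}"
    unfolding limitin_def openin_discrete_topology by (metis UNIV_I singletonI subset_UNIV)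
  then show "(\<lambda>n. real (u n)) \<longlonglongrightarrow> real l"
    by (intro tendsto_eventually) (auto elim: eventually_mono)
next
  assume "(\<lambda>n. real (u n)) \<longlonglongrightarrow> real l"
  then have "\<forall>\<^sub>F n in sequentially. dist (real (u n)) (real l) < 1" by (rule tendstoD) simp
  then have "\<forall>\<^sub>F n in sequentially. u n = l" by (rule eventually_mono) (auto simp: dist_real_def)
  then show "limitin (discrete_topology UNIV) u l sequentially"
    unfolding limitin_def by (auto elim: eventually_mono)
qed

lemma cont_conv_discrete_nat_iff:
  "cont_conv X (discrete_topology UNIV) F f \<longleftrightarrow>
     cont_conv X euclideanreal (\<lambda>m c. real (F m c)) (\<lambda>c. real (f c))"
  unfolding cont_conv_def by (simp add: limitin_discrete_nat_iff)

lemma continuous_map_discrete_nat_I: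
  assumes "continuous_map X euclideanreal (\<lambda>c. real (g c))"
  shows "continuous_map X (discrete_topology UNIV) g"
  unfolding continuous_map_def
proof (intro conjI allI impI)
  fix U :: "nat set"
  have "open (\<Union>n\<in>U. ball (real n) 1)" by auto
  then have "openin X {c \<in> topspace X. real (g c) \<in> (\<Union>n\<in>U. ball (real n) 1)}"
    by (intro openin_continuous_map_preimage[OF assms]) simp
  moreover have "real (g c) \<in> (\<Union>n\<in>U. ball (real n) 1) \<longleftrightarrow> g c \<in> U" for c
  proof -
    have "real (g c) \<in> ball (real n) 1 \<longleftrightarrow> g c = n" for n by (auto simp: dist_real_def)
    then show ?thesis by auto
  qed
  ultimately show "openin X {c \<in> topspace X. g c \<in> U}" by (simp only:)
qed simp

context extension_data
begin

text \<open>The weights form a partition of unity over closeness patterns: they make the selected value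
  depend continuously on the sampled values.\<close>

definition weight :: "real \<Rightarrow> nat \<Rightarrow> (nat \<Rightarrow> real) \<Rightarrow> (nat \<times> nat) set \<Rightarrow> real" where
  "weight e n v E = (\<Prod>p\<in>E. bump e \<bar>v (fst p) - v (snd p)\<bar>) *
     (\<Prod>p\<in>{..n} \<times> {..n} - E. 1 - bump e \<bar>v (fst p) - v (snd p)\<bar>)"

definition avg :: "real \<Rightarrow> nat \<Rightarrow> (nat \<Rightarrow> real) \<Rightarrow> tok set set \<Rightarrow> real" where
  "avg e n v c = (\<Sum>E\<in>Pow ({..n} \<times> {..n}). weight e n v E * v (select n E c))"

text \<open>At points near \<open>A\<close> the averages at scale \<open>1/2^p\<close> are eventually correct up to \<open>3/2^p\<close>, but
  how far one has to go depends on \<open>p\<close>. Clipping the successive differences makes the contribution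
  of the scales that are not yet correct summably small.\<close>

definition smooth :: "nat \<Rightarrow> (nat \<Rightarrow> real) \<Rightarrow> tok set set \<Rightarrow> real" where
  "smooth n v c = avg 1 n v c +
     (\<Sum>p<n. clip (5 / 2 ^ p) (avg (1 / 2 ^ Suc p) n v c - avg (1 / 2 ^ p) n v c))"

text \<open>For natural-number values, equality of samples is itself a closeness pattern at scale
  \<open>1 / 3\<close>, so a single selected sample serves as the value.\<close>

definition sharp :: "nat \<Rightarrow> (nat \<Rightarrow> 'b) \<Rightarrow> tok set set \<Rightarrow> 'b" where
  "sharp n v c = v (select n {(i, l). v i = v l} c)"

definition rank :: "tok set set \<Rightarrow> nat" where
  "rank c = (LEAST n. c \<notin> C n)"

text \<open>Precision is tied to \<open>rank\<close>, which is locally constant off \<open>A\<close>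
  and grows without bound towards \<open>A\<close>.\<close>

definition extend :: "(nat \<Rightarrow> (nat \<Rightarrow> 'b) \<Rightarrow> tok set set \<Rightarrow> 'b) \<Rightarrow> (tok set set \<Rightarrow> 'b) \<Rightarrow> tok set set \<Rightarrow> 'b" where
  "extend H f c = (if c \<in> A then f c else H (rank c) (\<lambda>i. f (sample i)) c)"

lemma weight_sum: "(\<Sum>E\<in>Pow ({..n} \<times> {..n}). weight e n v E) = 1"
  \<comment> \<open>The sum over subsets expands the product of the factors
    \<open>b + (1 - b)\<close>, each equal to 1.\<close>
  unfolding weight_def by (subst prod_add[symmetric]) auto

lemma weight_nonneg: "0 \<le> weight e n v E"
  unfolding weight_def bump_def by (intro mult_nonneg_nonneg prod_nonneg ballI) auto

text \<open>A pair closer than \<open>e\<close> left out of \<open>E\<close>, or a pair at distance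
  at least \<open>2 * e\<close> put in, contributes a zero factor.\<close>

lemma weight_pattern:
  assumes e: "e > 0" and E: "E \<subseteq> {..n} \<times> {..n}" and w: "weight e n v E \<noteq> 0"
  shows "pattern e n v E"
  unfolding pattern_def
proof (intro allI impI conjI)
  fix i l assume il: "i \<le> n" "l \<le> n"
  have fin: "finite E" "finite ({..n} \<times> {..n} - E)" using E finite_subset by auto
  show "(i, l) \<in> E" if "\<bar>v i - v l\<bar> < e"
  proof (rule ccontr)
    assume "(i, l) \<notin> E"
    then have p: "(i, l) \<in> {..n} \<times> {..n} - E" using il by simp
    have "1 - bump e \<bar>v i - v l\<bar> = 0" using that e by (simp add: bump_def min_def max_def field_simps)
    then have "(\<Prod>p\<in>{..n} \<times> {..n} - E. 1 - bump e \<bar>v (fst p) - v (snd p)\<bar>) = 0"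
      using fin(2) p by (intro prod_zero) force+
    then show False using w by (simp add: weight_def)
  qed
  show "\<bar>v i - v l\<bar> < 2 * e" if p: "(i, l) \<in> E"
  proof (rule ccontr)
    assume "\<not> \<bar>v i - v l\<bar> < 2 * e"
    then have "bump e \<bar>v i - v l\<bar> = 0" using e by (simp add: bump_def min_def max_def field_simps)
    then have "(\<Prod>p\<in>E. bump e \<bar>v (fst p) - v (snd p)\<bar>) = 0"
      using fin(1) p by (intro prod_zero) force+
    then show False using w by (simp add: weight_def)
  qed
qed

text \<open>The average is a convex combination in which sets that are not patterns have weight
  zero.\<close>

lemma avg_near:
  assumes e: "e > 0" and near: "\<And>E. pattern e n v E \<Longrightarrow> \<bar>v (select n E c) - r\<bar> < d"
  shows "\<bar>avg e n v c - r\<bar> \<le> d"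
proof -
  let ?P = "Pow ({..n} \<times> {..n})"
  have "avg e n v c - r = (\<Sum>E\<in>?P. weight e n v E * v (select n E c)) - (\<Sum>E\<in>?P. weight e n v E) * r"
    by (simp add: avg_def weight_sum)
  also have "\<dots> = (\<Sum>E\<in>?P. weight e n v E * (v (select n E c) - r))"
    by (simp add: sum_distrib_right sum_subtractf right_diff_distrib)
  also have "\<bar>\<dots>\<bar> \<le> (\<Sum>E\<in>?P. \<bar>weight e n v E * (v (select n E c) - r)\<bar>)" by (rule sum_abs)
  also have "\<dots> \<le> (\<Sum>E\<in>?P. weight e n v E * d)"
  proof (rule sum_mono)
    fix E assume "E \<in> ?P"
    show "\<bar>weight e n v E * (v (select n E c) - r)\<bar> \<le> weight e n v E * d"
    proof (cases "weight e n v E = 0")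
      case False
      then have "pattern e n v E" using \<open>E \<in> ?P\<close> by (intro weight_pattern[OF e]) auto
      then have "\<bar>v (select n E c) - r\<bar> \<le> d" by (rule less_imp_le[OF near])
      then show ?thesis using weight_nonneg[of e n v E] by (simp add: abs_mult mult_left_mono)
    qed simp
  qed
  also have "\<dots> = d" by (simp add: weight_sum flip: sum_distrib_right)
  finally show ?thesis .
qed

lemma tendsto_avg:
  assumes "\<And>i. (\<lambda>m. V m i) \<longlonglongrightarrow> v i" and "e > 0"
  shows "(\<lambda>m. avg e n (V m) c) \<longlonglongrightarrow> avg e n v c"
  unfolding avg_def weight_def bump_def
  by (intro tendsto_intros assms(1)) (use assms(2) in auto)

lemma tendsto_smooth:
  assumes "\<And>i. (\<lambda>m. V m i) \<longlonglongrightarrow> v i"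
  shows "(\<lambda>m. smooth n (V m) c) \<longlonglongrightarrow> smooth n v c"
  unfolding smooth_def clip_def by (intro tendsto_intros tendsto_avg assms) auto

lemma sample_in: "sample i \<in> topspace (subtopology (Ct k) A)"
  using z_total z_A by (simp add: sample_def)

lemma cont_conv_at_sample:
  assumes "cont_conv (subtopology (Ct k) A) euclideanreal F f"
  shows "(\<lambda>m. F m (sample i)) \<longlonglongrightarrow> f (sample i)"
proof -
  have "limitin (subtopology (Ct k) A) (\<lambda>_. sample i) (sample i) sequentially" using sample_in by simp
  then have "limitin euclideanreal (\<lambda>m. F m (sample i)) (f (sample i)) sequentially"
    using assms[unfolded cont_conv_def, rule_format, OF sample_in[of i], of "\<lambda>_. sample i"] sample_in[of i] by auto
  then show ?thesis by simp
qed

text \<open>Only the scales up to one fixed \<open>P\<close> are made correct, each to within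
  \<open>3 / 2 ^ p\<close> by \<open>selected_near\<close>. Clipping controls the rest, and
  \<open>P\<close> is chosen so that the total error \<open>13 / 2 ^ P\<close> is below
  \<open>e\<close>.\<close>

lemma smooth_near:
  assumes conv: "cont_conv (subtopology (Ct k) A) euclideanreal F f"
    and x: "x \<in> total_elems k" "cls k x \<in> A" and e: "e > 0"
  shows "\<exists>N. \<forall>\<^sub>F y in nhds_total k x. \<forall>m\<ge>N. \<forall>n\<ge>N. \<bar>smooth n (\<lambda>i. F m (sample i)) (cls k y) - f (cls k x)\<bar> < e"
proof -
  obtain P where P: "(1 / 2) ^ P < e / 13" using real_arch_pow_inv[of "e / 13" "1 / 2"] e by auto
  define Q where "Q p y m n \<longleftrightarrow> (\<forall>E. pattern (1 / 2 ^ p) n (\<lambda>i. F m (sample i)) E \<longrightarrow>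
      \<bar>F m (sample (select n E (cls k y))) - f (cls k x)\<bar> < 3 * (1 / 2 ^ p))" for p y m n
  define R where "R p N \<longleftrightarrow> (\<forall>\<^sub>F y in nhds_total k x. \<forall>m\<ge>N. \<forall>n\<ge>N. Q p y m n)" for p N
  have "\<exists>N. R p N" for p unfolding R_def Q_def by (rule selected_near[OF conv x]) simp
  then obtain L where "\<And>p. R p (L p)" by metis
  then have L: "\<forall>\<^sub>F y in nhds_total k x. \<forall>m\<ge>L p. \<forall>n\<ge>L p. Q p y m n" for p unfolding R_def .
  define N where "N = P + sum L {..P}"
  have "L p \<le> sum L {..P}" if "p \<le> P" for p using that by (intro member_le_sum) auto
  then have N: "P \<le> N" "\<And>p. p \<le> P \<Longrightarrow> L p \<le> N" unfolding N_def by (auto intro: trans_le_add2)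
  have "\<forall>\<^sub>F y in nhds_total k x. \<forall>p\<in>{..P}. \<forall>m\<ge>L p. \<forall>n\<ge>L p. Q p y m n"
    by (rule eventually_ball_finite) (use L in auto)
  then have "\<forall>\<^sub>F y in nhds_total k x. \<forall>m\<ge>N. \<forall>n\<ge>N. \<bar>smooth n (\<lambda>i. F m (sample i)) (cls k y) - f (cls k x)\<bar> < e"
  proof (rule eventually_mono, intro allI impI)
    fix y m n assume *: "\<forall>p\<in>{..P}. \<forall>m\<ge>L p. \<forall>n\<ge>L p. Q p y m n" and mn: "N \<le> m" "N \<le> n"
    let ?v = "\<lambda>i. F m (sample i)"
    have d: "\<bar>avg (1 / 2 ^ p) n ?v (cls k y) - f (cls k x)\<bar> \<le> 3 / 2 ^ p" if p: "p \<le> P" for p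
    proof -
      have "Q p y m n" using * p N(2)[OF p] mn by (meson atMost_iff order_trans)
      then show ?thesis using avg_near[of "1 / 2 ^ p" n ?v "cls k y" "f (cls k x)" "3 / 2 ^ p"]
        by (simp add: Q_def)
    qed
    have "smooth n ?v (cls k y) = avg (1 / 2 ^ 0) n ?v (cls k y) +
        (\<Sum>p<n. clip (5 / 2 ^ p) (avg (1 / 2 ^ Suc p) n ?v (cls k y) - avg (1 / 2 ^ p) n ?v (cls k y)))"
      by (simp add: smooth_def)
    also have "\<bar>\<dots> - f (cls k x)\<bar> \<le> 13 / 2 ^ P - 10 / 2 ^ n"
      by (rule abs_telescope_clip_le[OF d]) (use N(1) mn in auto)
    also have "\<dots> \<le> 13 * (1 / 2) ^ P" by (simp add: power_divide)
    also have "\<dots> < e" using P by simp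
    finally show "\<bar>smooth n ?v (cls k y) - f (cls k x)\<bar> < e" .
  qed
  then show ?thesis by (intro exI[of _ N])
qed

text \<open>The point enters only through \<open>select\<close>, whose neighbourhood of constancy
  does not depend on \<open>v\<close>; one neighbourhood therefore serves all
  \<open>F m\<close>.\<close>

lemma smooth_local:
  assumes "x \<in> total_elems k"
  shows "\<forall>\<^sub>F y in nhds_total k x. \<forall>v. smooth n v (cls k y) = smooth n v (cls k x)"
  using select_local[OF assms, of n] by (rule eventually_mono) (simp add: smooth_def avg_def)

lemma sharp_local:
  assumes "x \<in> total_elems k"
  shows "\<forall>\<^sub>F y in nhds_total k x. \<forall>v. sharp n v (cls k y) = sharp n v (cls k x)"
  using select_local[OF assms, of n] by (rule eventually_mono) (simp add: sharp_def)

lemma sharp_real: "real (sharp n v c) = sharp n (\<lambda>i. real (v i)) c"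
  by (simp add: sharp_def)

lemma extend_sharp_real: "real (extend sharp f c) = extend sharp (\<lambda>c. real (f c)) c"
  by (simp add: extend_def sharp_real)

text \<open>Convergent natural numbers are eventually constant, and stage \<open>n\<close> reads
  only the samples up to \<open>n\<close>.\<close>

lemma tendsto_sharp:
  fixes V :: "nat \<Rightarrow> nat \<Rightarrow> nat"
  assumes "\<And>i. (\<lambda>m. real (V m i)) \<longlonglongrightarrow> real (v i)"
  shows "(\<lambda>m. sharp n (\<lambda>i. real (V m i)) c) \<longlonglongrightarrow> sharp n (\<lambda>i. real (v i)) c"
proof (rule tendsto_eventually)
  have "\<forall>\<^sub>F m in sequentially. \<forall>i\<in>{..n}. V m i = v i"
  proof (rule eventually_ball_finite)
    show "\<forall>i\<in>{..n}. \<forall>\<^sub>F m in sequentially. V m i = v i"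
    proof
      fix i
      have "\<forall>\<^sub>F m in sequentially. dist (real (V m i)) (real (v i)) < 1"
        using assms[of i] by (rule tendstoD) simp
      then show "\<forall>\<^sub>F m in sequentially. V m i = v i" by (rule eventually_mono) (auto simp: dist_real_def)
    qed
  qed simp
  then show "\<forall>\<^sub>F m in sequentially. sharp n (\<lambda>i. real (V m i)) c = sharp n (\<lambda>i. real (v i)) c"
  proof (rule eventually_mono)
    fix m assume *: "\<forall>i\<in>{..n}. V m i = v i"
    have "select n {(i, l). real (V m i) = real (V m l)} c = select n {(i, l). real (v i) = real (v l)} c"
      by (rule select_cong) (use * in simp)
    then show "sharp n (\<lambda>i. real (V m i)) c = sharp n (\<lambda>i. real (v i)) c"
      using * select_le[of n _ c] by (simp add: sharp_def)
  qed
qed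

text \<open>At scale \<open>1 / 3\<close> the error bound of \<open>selected_near\<close> is 1, and
  naturals at distance below 1 coincide.\<close>

lemma sharp_near:
  fixes F :: "nat \<Rightarrow> tok set set \<Rightarrow> nat"
  assumes conv: "cont_conv (subtopology (Ct k) A) euclideanreal (\<lambda>m c. real (F m c)) (\<lambda>c. real (f c))"
    and x: "x \<in> total_elems k" "cls k x \<in> A" and e: "e > 0"
  shows "\<exists>N. \<forall>\<^sub>F y in nhds_total k x. \<forall>m\<ge>N. \<forall>n\<ge>N.
    \<bar>sharp n (\<lambda>i. real (F m (sample i))) (cls k y) - real (f (cls k x))\<bar> < e"
proof -
  obtain N where N: "\<forall>\<^sub>F y in nhds_total k x. \<forall>m\<ge>N. \<forall>n\<ge>N. \<forall>E. pattern (1 / 3) n (\<lambda>i. real (F m (sample i))) E \<longrightarrow>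
      \<bar>real (F m (sample (select n E (cls k y)))) - real (f (cls k x))\<bar> < 3 * (1 / 3)"
    using selected_near[OF conv x, of "1 / 3"] by auto
  have pat: "pattern (1 / 3) n (\<lambda>i. real (F m (sample i))) {(i, l). real (F m (sample i)) = real (F m (sample l))}" for m n
  proof -
    have "p = q" if "\<bar>real p - real q\<bar> < 1 / 3" for p q :: nat using that by linarith
    then show ?thesis by (simp add: pattern_def)
  qed
  have "\<forall>\<^sub>F y in nhds_total k x. \<forall>m\<ge>N. \<forall>n\<ge>N.
      \<bar>sharp n (\<lambda>i. real (F m (sample i))) (cls k y) - real (f (cls k x))\<bar> < e"
    using N
  proof (rule eventually_mono, intro allI impI)
    fix y m n
    assume *: "\<forall>m\<ge>N. \<forall>n\<ge>N. \<forall>E. pattern (1 / 3) n (\<lambda>i. real (F m (sample i))) E \<longrightarrow>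
      \<bar>real (F m (sample (select n E (cls k y)))) - real (f (cls k x))\<bar> < 3 * (1 / 3)" and mn: "N \<le> m" "N \<le> n"
    have "\<bar>real (F m (sample (select n {(i, l). real (F m (sample i)) = real (F m (sample l))} (cls k y)))) - real (f (cls k x))\<bar> < 3 * (1 / 3)"
      using * mn pat by blast
    then have "F m (sample (select n {(i, l). real (F m (sample i)) = real (F m (sample l))} (cls k y))) = f (cls k x)" by simp
    then show "\<bar>sharp n (\<lambda>i. real (F m (sample i))) (cls k y) - real (f (cls k x))\<bar> < e"
      unfolding sharp_def using e by simp
  qed
  then show ?thesis by (intro exI[of _ N])
qed

text \<open>The common interface of \<open>smooth\<close> and \<open>sharp\<close>: local constancy
  and convergence at each stage serve points off \<open>A\<close>, the joint estimate in
  \<open>m\<close> and \<open>n\<close> serves points of \<open>A\<close>.\<close>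

definition approximates ::
  "(nat \<Rightarrow> (nat \<Rightarrow> real) \<Rightarrow> tok set set \<Rightarrow> real) \<Rightarrow> (nat \<Rightarrow> tok set set \<Rightarrow> real) \<Rightarrow> (tok set set \<Rightarrow> real) \<Rightarrow> bool" where
  "approximates H F f \<longleftrightarrow> cont_conv (subtopology (Ct k) A) euclideanreal F f \<and>
     (\<forall>n. \<forall>x\<in>total_elems k. \<forall>\<^sub>F y in nhds_total k x. \<forall>v. H n v (cls k y) = H n v (cls k x)) \<and>
     (\<forall>n c. (\<lambda>m. H n (\<lambda>i. F m (sample i)) c) \<longlonglongrightarrow> H n (\<lambda>i. f (sample i)) c) \<and>
     (\<forall>x\<in>total_elems k. \<forall>e>0. cls k x \<in> A \<longrightarrow>
        (\<exists>N. \<forall>\<^sub>F y in nhds_total k x. \<forall>m\<ge>N. \<forall>n\<ge>N. \<bar>H n (\<lambda>i. F m (sample i)) (cls k y) - f (cls k x)\<bar> < e))"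

lemma approximates_smooth:
  assumes "cont_conv (subtopology (Ct k) A) euclideanreal F f"
  shows "approximates smooth F f"
  unfolding approximates_def
  by (intro conjI allI ballI impI assms smooth_local tendsto_smooth cont_conv_at_sample[OF assms] smooth_near[OF assms])

lemma approximates_sharp:
  fixes F :: "nat \<Rightarrow> tok set set \<Rightarrow> nat"
  assumes "cont_conv (subtopology (Ct k) A) euclideanreal (\<lambda>m c. real (F m c)) (\<lambda>c. real (f c))"
  shows "approximates sharp (\<lambda>m c. real (F m c)) (\<lambda>c. real (f c))"
  unfolding approximates_def
  by (intro conjI allI ballI impI assms sharp_local tendsto_sharp cont_conv_at_sample[OF assms] sharp_near[OF assms])

section \<open>Gluing along the clopen sets\<close>

lemma rank_notin: "c \<notin> A \<Longrightarrow> c \<notin> C (rank c)"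
  unfolding rank_def A_eq by (rule LeastI_ex) simp

lemma in_below_rank: "n < rank c \<Longrightarrow> c \<in> C n"
  unfolding rank_def using not_less_Least by blast

lemma rank_local:
  assumes "x \<in> total_elems k" "cls k x \<notin> A"
  shows "\<forall>\<^sub>F y in nhds_total k x. cls k y \<notin> A \<and> rank (cls k y) = rank (cls k x)"
proof -
  have "\<forall>\<^sub>F y in nhds_total k x. \<forall>i\<in>{..rank (cls k x)}. cls k y \<in> C i \<longleftrightarrow> cls k x \<in> C i"
    by (rule eventually_nhds_total_finite_clopens) (use assms C_clopen in auto)
  then show ?thesis
  proof eventually_elim
    case (elim y)
    have out: "cls k y \<notin> C (rank (cls k x))" using elim rank_notin[OF assms(2)] by simp
    moreover have "rank (cls k x) \<le> n" if "cls k y \<notin> C n" for n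
      using that elim in_below_rank[of n "cls k x"] by (cases "n < rank (cls k x)") auto
    ultimately have "rank (cls k y) = rank (cls k x)"
      unfolding rank_def[of "cls k y"] by (rule Least_equality)
    then show ?case using out A_eq by blast
  qed
qed

lemma rank_large:
  assumes "x \<in> total_elems k" "cls k x \<in> A"
  shows "\<forall>\<^sub>F y in nhds_total k x. cls k y \<notin> A \<longrightarrow> N \<le> rank (cls k y)"
proof -
  have "\<forall>\<^sub>F y in nhds_total k x. \<forall>i\<in>{..N}. cls k y \<in> C i \<longleftrightarrow> cls k x \<in> C i"
    by (rule eventually_nhds_total_finite_clopens) (use assms C_clopen in auto)
  then show ?thesis
  proof eventually_elim
    case (elim y)
    then have "cls k y \<in> C i" if "i \<le> N" for i using assms(2) A_eq that by auto
    then show ?case using rank_notin[of "cls k y"] by (meson nat_le_linear)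
  qed
qed

text \<open>Near a point of \<open>A\<close>, a point of \<open>A\<close> is handled by continuous
  convergence and any other has large rank, hence a precise approximation. Near a point off
  \<open>A\<close> the stage is fixed, and only convergence in \<open>m\<close> remains.\<close>

lemma extend_locally_uniform:
  assumes H: "approximates H F f" and x: "x \<in> total_elems k" and e: "e > 0"
  shows "\<exists>N. \<forall>\<^sub>F y in nhds_total k x. \<forall>m\<ge>N. \<bar>extend H (F m) (cls k y) - extend H f (cls k x)\<bar> < e"
proof (cases "cls k x \<in> A")
  case True
  have conv: "cont_conv (subtopology (Ct k) A) euclideanreal F f" using H by (simp add: approximates_def)
  obtain M where M: "\<forall>\<^sub>F y in nhds_total k x. \<forall>m\<ge>M. cls k y \<in> A \<longrightarrow> \<bar>F m (cls k y) - f (cls k x)\<bar> < e"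
    using cont_conv_eventually_near[OF conv x True e] by blast
  obtain N where N: "\<forall>\<^sub>F y in nhds_total k x. \<forall>m\<ge>N. \<forall>n\<ge>N. \<bar>H n (\<lambda>i. F m (sample i)) (cls k y) - f (cls k x)\<bar> < e"
    using H x True e unfolding approximates_def by blast
  have "\<forall>\<^sub>F y in nhds_total k x. \<forall>m\<ge>max M N. \<bar>extend H (F m) (cls k y) - extend H f (cls k x)\<bar> < e"
    using M N rank_large[OF x True, of N] by eventually_elim (use True in \<open>simp add: extend_def\<close>)
  then show ?thesis by (intro exI[of _ "max M N"])
next
  case False
  let ?n = "rank (cls k x)"
  have "(\<lambda>m. H ?n (\<lambda>i. F m (sample i)) (cls k x)) \<longlonglongrightarrow> H ?n (\<lambda>i. f (sample i)) (cls k x)"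
    using H by (simp add: approximates_def)
  then obtain N where N: "\<And>m. m \<ge> N \<Longrightarrow>
      \<bar>H ?n (\<lambda>i. F m (sample i)) (cls k x) - H ?n (\<lambda>i. f (sample i)) (cls k x)\<bar> < e"
    using e unfolding LIMSEQ_def dist_real_def by blast
  have "\<forall>\<^sub>F y in nhds_total k x. \<forall>v. H ?n v (cls k y) = H ?n v (cls k x)"
    using H x by (simp add: approximates_def)
  then have "\<forall>\<^sub>F y in nhds_total k x. \<forall>m\<ge>N. \<bar>extend H (F m) (cls k y) - extend H f (cls k x)\<bar> < e"
    using rank_local[OF x False] by eventually_elim (use False N in \<open>simp add: extend_def\<close>)
  then show ?thesis by (intro exI[of _ N])
qed

text \<open>Continuity is the case of a constant sequence.\<close>

lemma extend_locally_continuous: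
  assumes "approximates H (\<lambda>_. f) f" "x \<in> total_elems k" "e > 0"
  shows "\<forall>\<^sub>F y in nhds_total k x. \<bar>extend H f (cls k y) - extend H f (cls k x)\<bar> < e"
  using extend_locally_uniform[OF assms] by (auto elim: eventually_mono)

lemma continuous_map_extend:
  assumes "approximates H (\<lambda>_. f) f"
  shows "continuous_map (Ct k) euclideanreal (extend H f)"
  by (rule continuous_map_Ct_I) (rule extend_locally_continuous[OF assms])

lemma cont_conv_extend:
  assumes "approximates H F f" "\<And>m. approximates H (\<lambda>_. F m) (F m)"
  shows "cont_conv (Ct k) euclideanreal (\<lambda>m. extend H (F m)) (extend H f)"
  by (rule cont_conv_Ct_I) (use extend_locally_uniform[OF assms(1)] extend_locally_continuous[OF assms(2)] in blast)+

section \<open>The extensions as maps between function spaces\<close>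

definition extend_op :: "(nat \<Rightarrow> (nat \<Rightarrow> 'b) \<Rightarrow> tok set set \<Rightarrow> 'b) \<Rightarrow> (tok set set \<Rightarrow> 'b) \<Rightarrow> tok set set \<Rightarrow> 'b" where
  "extend_op H f = restrict (extend H f) (topspace (Ct k))"

lemma A_subset: "A \<subseteq> topspace (Ct k)"
  using C_clopen[of 0] openin_subset A_eq by blast

lemma extend_op_extends: "c \<in> A \<Longrightarrow> extend_op H f c = f c"
  using A_subset by (auto simp: extend_op_def extend_def)

lemma extend_op_cfun_I: "continuous_map (Ct k) Y (extend H f) \<Longrightarrow> extend_op H f \<in> cfun (Ct k) Y"
  unfolding cfun_def extend_op_def by (auto intro: continuous_map_eq)

lemma cont_conv_extend_op_iff:
  "cont_conv (Ct k) Y (\<lambda>m. extend_op H (F m)) (extend_op H f) \<longleftrightarrow>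
     cont_conv (Ct k) Y (\<lambda>m. extend H (F m)) (extend H f)"
  by (rule cont_conv_cong) (simp_all add: extend_op_def)

lemma continuous_extend_op_real:
  "continuous_map (cfun_topology (subtopology (Ct k) A) euclideanreal)
     (cfun_topology (Ct k) euclideanreal) (extend_op smooth)"
proof (rule continuous_map_cfun_topology_I)
  have const: "approximates smooth (\<lambda>_. f) f" if "f \<in> cfun (subtopology (Ct k) A) euclideanreal" for f
    using that by (intro approximates_smooth cont_conv_const) (simp add: cfun_def)
  show "extend_op smooth f \<in> cfun (Ct k) euclideanreal"
    if "f \<in> cfun (subtopology (Ct k) A) euclideanreal" for f
    by (intro extend_op_cfun_I continuous_map_extend const that)
  fix F f assume "range F \<subseteq> cfun (subtopology (Ct k) A) euclideanreal"
    and "cont_conv (subtopology (Ct k) A) euclideanreal F f"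
  then show "cont_conv (Ct k) euclideanreal (\<lambda>m. extend_op smooth (F m)) (extend_op smooth f)"
    unfolding cont_conv_extend_op_iff by (intro cont_conv_extend approximates_smooth const) auto
qed

lemma continuous_extend_op_nat:
  "continuous_map (cfun_topology (subtopology (Ct k) A) (discrete_topology (UNIV :: nat set)))
     (cfun_topology (Ct k) (discrete_topology (UNIV :: nat set))) (extend_op sharp)"
proof (rule continuous_map_cfun_topology_I)
  let ?Y = "discrete_topology (UNIV :: nat set)"
  have const: "approximates sharp (\<lambda>_ c. real (f c)) (\<lambda>c. real (f c))"
    if "f \<in> cfun (subtopology (Ct k) A) ?Y" for f
    by (rule approximates_sharp[of "\<lambda>_. f" f], unfold cont_conv_discrete_nat_iff[symmetric])
      (use that in \<open>simp add: cont_conv_const cfun_def\<close>)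
  show "extend_op sharp f \<in> cfun (Ct k) ?Y" if "f \<in> cfun (subtopology (Ct k) A) ?Y" for f
    by (intro extend_op_cfun_I continuous_map_discrete_nat_I)
      (simp add: extend_sharp_real continuous_map_extend const that)
  fix F f assume F: "range F \<subseteq> cfun (subtopology (Ct k) A) ?Y"
    and conv: "cont_conv (subtopology (Ct k) A) ?Y F f"
  have "cont_conv (Ct k) euclideanreal (\<lambda>m. extend sharp (\<lambda>c. real (F m c))) (extend sharp (\<lambda>c. real (f c)))"
    by (rule cont_conv_extend) (use conv F in \<open>auto intro: approximates_sharp const simp: cont_conv_discrete_nat_iff\<close>)
  then show "cont_conv (Ct k) ?Y (\<lambda>m. extend_op sharp (F m)) (extend_op sharp f)"
    unfolding cont_conv_extend_op_iff unfolding cont_conv_discrete_nat_iff by (simp add: extend_sharp_real)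
qed

end

section \<open>Constructing the data and concluding\<close>

lemma extension_data_exists:
  assumes C: "\<And>n. openin (Ct k) (C n) \<and> closedin (Ct k) (C n)" and A: "A = (\<Inter>n. C n)" and ne: "A \<noteq> {}"
  obtains s z B where "extension_data k A s z B C"
proof -
  define \<S> where "\<S> = {\<sigma>. finite \<sigma> \<and> (\<exists>x\<in>total_elems k. cls k x \<in> A \<and> \<sigma> \<subseteq> x)}"
  have AX: "A \<subseteq> topspace (Ct k)" using openin_subset[of "Ct k" "C 0"] C A by blast
  then obtain x0 where "x0 \<in> total_elems k" "cls k x0 \<in> A" using ne by (auto simp: topspace_Ct_cls)
  then have "{} \<in> \<S>" by (auto simp: \<S>_def)
  then have ne': "\<S> \<noteq> {}" by blast
  have cnt: "countable \<S>"
    by (rule countable_subset[OF _ countable_Collect_finite]) (auto simp: \<S>_def)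
  define s where "s = from_nat_into \<S>"
  have s: "s i \<in> \<S>" for i unfolding s_def by (rule from_nat_into[OF ne'])
  then have "\<exists>x. x \<in> total_elems k \<and> cls k x \<in> A \<and> s i \<subseteq> x" for i by (auto simp: \<S>_def)
  then obtain z where z: "\<And>i. z i \<in> total_elems k" "\<And>i. cls k (z i) \<in> A" "\<And>i. s i \<subseteq> z i" by metis
  have fin: "finite (s i)" for i using s[of i] by (simp add: \<S>_def)
  have cons: "consistent k (s i)" for i
    using z(3)[of i] total_elems_pdom[OF z(1)[of i]] by (auto simp: consistent_def)
  define sep where "sep i l B \<longleftrightarrow> openin (Ct k) B \<and> closedin (Ct k) B \<and>
      (\<forall>x\<in>total_elems k. (s i \<subseteq> x \<longrightarrow> cls k x \<in> B) \<and>
        (\<not> consistent k (s i \<union> s l) \<longrightarrow> s l \<subseteq> x \<longrightarrow> cls k x \<notin> B))" for i l B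
  have "\<exists>B. sep i l B" for i l
  proof (cases "consistent k (s i \<union> s l)")
    case True
    \<comment> \<open>A consistent pair demands no separation, so the whole space serves and
      excludes no point.\<close>
    then have "sep i l (topspace (Ct k))" by (auto simp: sep_def)
    then show ?thesis ..
  next
    case False
    have "separated k" using dense_total_separated by blast
    then have "\<exists>B. openin (Ct k) B \<and> closedin (Ct k) B \<and>
        (\<forall>x\<in>total_elems k. (s i \<subseteq> x \<longrightarrow> cls k x \<in> B) \<and> (s l \<subseteq> x \<longrightarrow> cls k x \<notin> B))"
      using False fin cons unfolding separated_def by metis
    then show ?thesis using False unfolding sep_def by simp
  qed
  then obtain B where B: "\<And>i l. sep i l (B i l)" by metis
  have "extension_data k A s z B C"
  proof
    show "\<exists>i. s i = \<sigma>" if "finite \<sigma>" "x \<in> total_elems k" "cls k x \<in> A" "\<sigma> \<subseteq> x" for \<sigma> x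
    proof -
      have "\<sigma> \<in> \<S>" using that by (auto simp: \<S>_def)
      then show ?thesis unfolding s_def using from_nat_into_surj[OF cnt] by blast
    qed
  qed (use C A z fin B in \<open>auto simp: sep_def\<close>)
  then show thesis by (rule that)
qed

lemma continuous_map_cfun_topology_const:
  assumes "g \<in> cfun X' Y'"
  shows "continuous_map (cfun_topology X Y) (cfun_topology X' Y') (\<lambda>_. g)"
  using assms by simp

lemma restrict_const_cfun:
  "y \<in> topspace Y \<Longrightarrow> restrict (\<lambda>_. y) (topspace X) \<in> cfun X Y"
  by (auto simp: cfun_def intro: continuous_map_eq[of _ _ "\<lambda>_. y"])

theorem theorem3p6:
  fixes k :: nat and A :: "tok set set set"
  assumes "A \<subseteq> topspace (Ct k)" and "Pi01_tilde (Ct k) A"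
  shows
    "(\<exists>\<Phi>. continuous_map
            (cfun_topology (subtopology (Ct k) A) euclideanreal)
            (cfun_topology (Ct k) euclideanreal) \<Phi> \<and>
          (\<forall>f \<in> cfun (subtopology (Ct k) A) euclideanreal. \<forall>a\<in>A. \<Phi> f a = f a)) \<and>
     (\<exists>\<Phi>. continuous_map
            (cfun_topology (subtopology (Ct k) A) (discrete_topology (UNIV :: nat set)))
            (cfun_topology (Ct k) (discrete_topology (UNIV :: nat set))) \<Phi> \<and>
          (\<forall>f \<in> cfun (subtopology (Ct k) A) (discrete_topology (UNIV :: nat set)).
             \<forall>a\<in>A. \<Phi> f a = f a))"
  (is "(\<exists>\<Phi>. ?R \<Phi> \<and> ?ER \<Phi>) \<and> (\<exists>\<Phi>. ?N \<Phi> \<and> ?EN \<Phi>)")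
proof (cases "A = {}")
  case True
  \<comment> \<open>An empty \<open>A\<close> has no points to sample; the constant function 0 is
    then an extension.\<close>
  have "?R (\<lambda>_. restrict (\<lambda>_. 0) (topspace (Ct k)))" "?N (\<lambda>_. restrict (\<lambda>_. 0) (topspace (Ct k)))"
    by (rule continuous_map_cfun_topology_const, rule restrict_const_cfun, simp)+
  moreover have "?ER \<Phi>" "?EN \<Psi>" for \<Phi> \<Psi> using True by simp_all
  ultimately show ?thesis by meson
next
  case False
  obtain C :: "nat \<Rightarrow> tok set set set"
    where C: "\<And>n. openin (Ct k) (C n) \<and> closedin (Ct k) (C n)" "A = (\<Inter>n. C n)"
    using assms(2) unfolding Pi01_tilde_def by blast
  obtain s z B where "extension_data k A s z B C"
    by (rule extension_data_exists[OF C False])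
  then interpret extension_data k A s z B C .
  have "?ER (extend_op smooth)" "?EN (extend_op sharp)" by (simp_all add: extend_op_extends)
  then show ?thesis using continuous_extend_op_real continuous_extend_op_nat by meson
qed

end
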